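(* Let $\mathcal{V},\mathcal{W}$ be real, separable, infinite-dimensional Hilbert spaces, fix $c>0$ and $p\in[1,\infty]$, and let $\mathcal{X}=\{v\in\mathcal{V}:\|v\|\le 1\}$, $\mathcal{Y}=\{w\in\mathcal{W}:\|w\|\le c\}$ and $\mathcal{F}_p=\{f\in S_p(\mathcal{V},\mathcal{W}):\|f\|_p\le c\}$. Then for every $T\in\mathbb{N}$, \[\inf_{\mathcal{A}}\mathtt{R}_{\mathcal{A}}(T,\mathcal{F}_p)\;\le\;2\,\mathrm{Rad}_T(\mathcal{F}_p)\;\le\;6c^2\,T^{\max\{\frac12,\,1-\frac1p\}},\] where the infimum ranges over all (possibly randomized) online learning algorithms.
   Context: For a compact linear operator $f:\mathcal{V}\to\mathcal{W}$ with singular values $(s_n(f))_{n\ge1}$, the $p$-Schatten norm is $\|f\|_p=(\sum_n s_n(f)^p)^{1/p}$ for $p\in[1,\infty)$ and $\|f\|_\infty=\sup_n s_n(f)$ (the operator norm); $S_p(\mathcal{V},\mathcal{W})$ is the set of compact linear operators $f$ with $\|f\|_p<\infty$. Online protocol: for $t=1,\dots,T$, an adversary picks $(x_t,y_t)\in\mathcal{X}\times\mathcal{Y}$ and reveals $x_t$; the learner $\mathcal{A}$, using $(x_1,y_1),\dots,(x_{t-1},y_{t-1})$ and $x_t$ (and possibly internal randomness), predicts $\mathcal{A}(x_t)=\hat y_t\in\mathcal{Y}$; then $y_t$ is revealed and the loss is $\|\hat y_t-y_t\|_{\mathcal{W}}^2$. The regret of $\mathcal{A}$ on a class $\mathcal{F}$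 of linear operators is \[\mathtt{R}_{\mathcal{A}}(T,\mathcal{F})=\sup_{(x_1,y_1),\dots,(x_T,y_T)\in\mathcal{X}\times\mathcal{Y}}\mathbb{E}\Big[\sum_{t=1}^T\|\mathcal{A}(x_t)-y_t\|^2-\inf_{f\in\mathcal{F}}\sum_{t=1}^T\|f(x_t)-y_t\|^2\Big],\] the expectation being over the algorithm's randomness. Sequential Rademacher complexity: with $\sigma=(\sigma_1,\dots,\sigma_T)$ i.i.d. uniform on $\{-1,1\}$ and $\sigma_{<t}=(\sigma_1,\dots,\sigma_{t-1})$, \[\mathrm{Rad}_T(\mathcal{F})=\sup_{x,y}\mathbb{E}_\sigma\Big[\sup_{f\in\mathcal{F}}\sum_{t=1}^T\sigma_t\|f(x_t(\sigma_{<t}))-y_t(\sigma_{<t})\|^2\Big],\] where the supremum is over all sequences of maps $(x_t,y_t):\{-1,1\}^{t-1}\to\mathcal{X}\times\mathcal{Y}$, $t=1,\dots,T$. *)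

theory Defs
  imports "HOL-Analysis.Analysis" "HOL-Probability.Probability"
begin

definition compact_op :: "('a::real_normed_vector \<Rightarrow> 'b::real_normed_vector) \<Rightarrow> bool" where
  "compact_op f \<longleftrightarrow> bounded_linear f \<and> compact (closure (f ` cball 0 1))"

text \<open>The n-th singular value (n \<ge> 1): the square root of the n-th largest eigenvalue of
f* f, counted with multiplicity. The n-th largest eigenvalue (with multiplicity) of the
positive self-adjoint operator f* f is the largest t such that there are n orthonormal
eigenvectors of f* f with eigenvalues at least t. The eigen-equation f* f e = mu e is
written out as  inner (f e) (f x) = mu * inner e x  for all x.\<close>
definition sing_val :: "('a::real_inner \<Rightarrow> 'b::real_inner) \<Rightarrow> nat \<Rightarrow> real" where
  "sing_val f n = sqrt (Sup ({0} \<union> {t. \<exists>e::nat \<Rightarrow> 'a.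
      (\<forall>i<n. \<forall>j<n. inner (e i) (e j) = (if i = j then 1 else 0)) \<and>
      (\<forall>i<n. \<exists>mu\<ge>t. \<forall>x. inner (f (e i)) (f x) = mu * inner (e i) x)}))"

text \<open>p-Schatten norm, p in [1,\<infinity>] (extended-real valued; \<infinity> if the series diverges).
Singular values are indexed from 1: s_1 = sing_val f 1, s_2 = sing_val f 2, ...\<close>
definition schatten_norm :: "ereal \<Rightarrow> ('a::real_inner \<Rightarrow> 'b::real_inner) \<Rightarrow> ereal" where
  "schatten_norm p f =
    (if p = \<infinity> then (SUP n. ereal (sing_val f (Suc n)))
     else if summable (\<lambda>n. sing_val f (Suc n) powr real_of_ereal p)
     then ereal ((\<Sum>n. sing_val f (Suc n) powr real_of_ereal p) powr (1 / real_of_ereal p))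
     else \<infinity>)"

definition schatten_ball :: "ereal \<Rightarrow> real \<Rightarrow> ('a::real_inner \<Rightarrow> 'b::real_inner) set" where
  "schatten_ball p c = {f. compact_op f \<and> schatten_norm p f \<le> ereal c}"

text \<open>Source of the learner's internal randomness: a uniform random variable on [0,1].\<close>
definition rand_space :: "real measure" where
  "rand_space = uniform_measure lborel {0..1}"

text \<open>(Possibly randomized) online learners: A omega history x_t is the prediction at a
round with past data "history" (list of the previous pairs) and current input x_t, using
internal randomness omega; predictions lie in Y.\<close>
definition online_algorithms ::
  "'w::real_normed_vector set \<Rightarrow> (real \<Rightarrow> ('v \<times> 'w) list \<Rightarrow> 'v \<Rightarrow> 'w) set" where
  "online_algorithms Y = {A. (\<forall>\<omega> h x. A \<omega> h x \<in> Y) \<and>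
      (\<forall>h x. (\<lambda>\<omega>. A \<omega> h x) \<in> borel_measurable rand_space)}"

text \<open>Regret (oblivious adversary: the sequence is fixed before the expectation).
Rounds are indexed t = 0..T-1; the history at round t is take t s.\<close>
definition regret ::
  "(real \<Rightarrow> ('v \<times> 'w) list \<Rightarrow> 'v \<Rightarrow> 'w::real_normed_vector) \<Rightarrow> nat \<Rightarrow> ('v \<Rightarrow> 'w) set
     \<Rightarrow> 'v set \<Rightarrow> 'w set \<Rightarrow> real" where
  "regret A T F X Y = (SUP s\<in>{s. length s = T \<and> set s \<subseteq> X \<times> Y}.
      (\<integral>\<omega>. (\<Sum>t<T. (norm (A \<omega> (take t s) (fst (s!t)) - snd (s!t)))^2) \<partial>rand_space)
      - (INF f\<in>F. \<Sum>t<T. (norm (f (fst (s!t)) - snd (s!t)))^2))"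

text \<open>Sequential Rademacher complexity. A tree is z :: nat => bool list => V x W, where
z t sigma (sigma of length t) is (x_{t+1}, y_{t+1}) as a function of the first t signs;
True encodes +1 and False encodes -1; the expectation over sigma is the uniform average
over all 2^T sign lists of length T.\<close>
definition seq_rademacher ::
  "nat \<Rightarrow> ('v \<Rightarrow> 'w::real_normed_vector) set \<Rightarrow> 'v set \<Rightarrow> 'w set \<Rightarrow> real" where
  "seq_rademacher T F X Y =
    (SUP z\<in>{z::nat \<Rightarrow> bool list \<Rightarrow> 'v \<times> 'w. \<forall>t<T. \<forall>\<sigma>. length \<sigma> = t \<longrightarrow> z t \<sigma> \<in> X \<times> Y}.
      (\<Sum>\<sigma>\<in>{\<sigma>::bool list. length \<sigma> = T}.
         (SUP f\<in>F. \<Sum>t<T. (if \<sigma>!t then 1 else -1) *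
             (norm (f (fst (z t (take t \<sigma>))) - snd (z t (take t \<sigma>))))^2)) / 2^T)"

end

theory Submission
  imports Defs
begin

text \<open>
  Regret versus Rademacher complexity: the learner keeps the sequential Rademacher complexity of the
  remaining rounds, offset by the losses so far, from increasing. Its prediction is obtained without a
  minimax theorem, as the mean of a near-optimal label distribution; convexity of the supremum in the
  offset gives the symmetrisation round by round.

  Rademacher bound: after expanding the square, the signed losses are Hilbert--Schmidt pairings of
  \<open>f\<close>, restricted to the span of \<open>x\<^sub>1, \<dots>, x\<^sub>T\<close>, with \<open>\<Sum>\<^sub>t \<sigma>\<^sub>t y\<^sub>t \<otimes> x\<^sub>t\<close> and
  \<open>f \<circ> (\<Sum>\<^sub>t \<sigma>\<^sub>t x\<^sub>t \<otimes> x\<^sub>t)\<close>. The squared Hilbert--Schmidt norms of the two random sums have mean at most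
  \<open>c\<^sup>2 T\<close> and \<open>T\<close>. On a space of dimension at most \<open>T\<close> the Hilbert--Schmidt norm of \<open>f\<close> is at most
  \<open>c\<close> times \<open>T\<close> to the power \<open>max 0 (1/2 - 1/p)\<close>, by Ky Fan's inequality and Young's.
\<close>

section \<open>Singular values and orthonormal systems\<close>

text \<open>The span of the inputs depends on the signs, so no basis can be fixed before averaging.
  The random tensors are therefore measured by Gram entries (\<open>tensor_square\<close>), which
  are predictable, and a basis is used only for one sign list at a time. The term
  \<open>(norm (f x))\<^sup>2\<close> is quadratic in \<open>f\<close>: one copy is kept for the
  pairing, the other is absorbed into the tensor at the price of its operator norm, at most
  \<open>c\<close>. What remains depends on \<open>f\<close> only through two norm bounds, so the
  supremum over \<open>f\<close> costs nothing. With Hilbert--Schmidt bound \<open>K\<close>, the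
  quadratic term contributes \<open>K * c * sqrt T\<close>, the cross term twice that, and the label
  term has mean zero; this gives 3, doubled to 6 in the regret bound. On the regret side the optimal
  label distribution need not exist, so each round loses a slack, which the infimum over learners
  removes. Since \<open>SUP\<close> and \<open>INF\<close> are real-valued, all of them need
  boundedness proofs.\<close>

definition orthonormal_upto :: "nat \<Rightarrow> (nat \<Rightarrow> 'a::real_inner) \<Rightarrow> bool" where
  "orthonormal_upto n e \<longleftrightarrow> (\<forall>i<n. \<forall>j<n. inner (e i) (e j) = (if i = j then 1 else 0))"

lemma orthonormal_upto_mono: "orthonormal_upto n e \<Longrightarrow> m \<le> n \<Longrightarrow> orthonormal_upto m e"
  by (auto simp: orthonormal_upto_def)

lemma orthonormal_upto_norm: "orthonormal_upto n e \<Longrightarrow> i < n \<Longrightarrow> norm (e i) = 1"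
  by (auto simp: orthonormal_upto_def norm_eq_sqrt_inner)

lemma orthonormal_upto_cong:
  "(\<And>i. i < n \<Longrightarrow> e i = e' i) \<Longrightarrow> orthonormal_upto n e \<longleftrightarrow> orthonormal_upto n e'"
  by (auto simp: orthonormal_upto_def)

lemma orthonormal_upto_Suc:
  assumes "orthonormal_upto n e" "norm (e n) = 1" "\<And>i. i < n \<Longrightarrow> inner (e i) (e n) = 0"
  shows "orthonormal_upto (Suc n) e"
  using assms
  by (auto simp: orthonormal_upto_def less_Suc_eq norm_eq_sqrt_inner inner_commute)

lemma orthonormal_upto_inner_sum:
  assumes "orthonormal_upto n e" "j < n"
  shows "inner (e j) (\<Sum>i<n. a i *\<^sub>R e i) = a j"
proof -
  have "inner (e j) (\<Sum>i<n. a i *\<^sub>R e i) = (\<Sum>i<n. if i = j then a j else 0)"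
    unfolding inner_sum_right
    by (rule sum.cong) (use assms in \<open>auto simp: orthonormal_upto_def\<close>)
  then show ?thesis using assms by simp
qed

lemma orthonormal_upto_residual:
  assumes "orthonormal_upto n e" "j < n"
  shows "inner (e j) (x - (\<Sum>i<n. inner (e i) x *\<^sub>R e i)) = 0"
  using orthonormal_upto_inner_sum[OF assms, of "\<lambda>i. inner (e i) x"] by (simp add: inner_diff_right)

lemma orthonormal_upto_Pythagoras:
  assumes "orthonormal_upto n e"
  shows "(norm x)\<^sup>2 = (\<Sum>i<n. (inner (e i) x)\<^sup>2) + (norm (x - (\<Sum>i<n. inner (e i) x *\<^sub>R e i)))\<^sup>2"
proof -
  define r where "r = x - (\<Sum>i<n. inner (e i) x *\<^sub>R e i)"
  have x: "x = (\<Sum>i<n. inner (e i) x *\<^sub>R e i) + r" by (simp add: r_def)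
  have "inner r (e i) = 0" if "i < n" for i
    using orthonormal_upto_residual[OF assms that, of x] by (simp add: r_def inner_commute[of "e i"])
  then have "inner r (\<Sum>i<n. inner (e i) x *\<^sub>R e i) = 0"
    by (simp add: inner_sum_right)
  then have "inner r x = inner r r"
    by (subst x) (simp add: inner_add_right)
  moreover have "inner x x = (\<Sum>i<n. (inner (e i) x)\<^sup>2) + inner r x"
    by (subst x) (simp add: inner_add_left inner_sum_left power2_eq_square)
  ultimately show ?thesis by (simp add: r_def power2_norm_eq_inner)
qed

lemma orthonormal_upto_Bessel:
  "orthonormal_upto n e \<Longrightarrow> (\<Sum>i<n. (inner (e i) x)\<^sup>2) \<le> (norm x)\<^sup>2"
  using orthonormal_upto_Pythagoras[of n e x] by simp

text \<open>Span membership is stated as an explicit expansion, and \<open>d\<close> counts only the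
  independent vectors. The bound \<open>d \<le> T\<close> is what later turns dimension into a power
  of \<open>T\<close>.\<close>

lemma Gram_Schmidt:
  fixes x :: "nat \<Rightarrow> 'a::real_inner"
  shows "\<exists>d\<le>T. \<exists>e. orthonormal_upto d e \<and> (\<forall>t<T. x t = (\<Sum>i<d. inner (e i) (x t) *\<^sub>R e i))"
proof (induction T)
  case 0
  show ?case by (auto simp: orthonormal_upto_def)
next
  case (Suc T)
  then obtain d e where d: "d \<le> T" and e: "orthonormal_upto d e"
    and x: "\<And>t. t < T \<Longrightarrow> x t = (\<Sum>i<d. inner (e i) (x t) *\<^sub>R e i)" by blast
  define r where "r = x T - (\<Sum>i<d. inner (e i) (x T) *\<^sub>R e i)"
  show ?case
  proof (cases "r = 0")
    case True
    then have "\<forall>t<Suc T. x t = (\<Sum>i<d. inner (e i) (x t) *\<^sub>R e i)"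
      using x by (auto simp: less_Suc_eq r_def)
    then show ?thesis using d e by (meson le_SucI)
  next
    case False
    define e' where "e' = e(d := r /\<^sub>R norm r)"
    have lt: "e' i = e i" if "i < d" for i using that by (simp add: e'_def)
    have orth: "inner (e i) r = 0" if "i < d" for i
      unfolding r_def using that by (rule orthonormal_upto_residual[OF e])
    have e': "orthonormal_upto (Suc d) e'"
    proof (rule orthonormal_upto_Suc)
      show "orthonormal_upto d e'" using e lt by (subst orthonormal_upto_cong[of d e' e]) auto
      show "norm (e' d) = 1" using False by (simp add: e'_def)
      show "inner (e' i) (e' d) = 0" if "i < d" for i
        using orth[OF that] that by (simp add: e'_def)
    qed
    \<comment> \<open>The new direction is orthogonal to all earlier inputs, so their expansions
      gain only a zero term.\<close>
    have rx: "inner r (x t) = 0" if "t < T" for t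
    proof (subst x[OF that])
      show "inner r (\<Sum>i<d. inner (e i) (x t) *\<^sub>R e i) = 0"
        using orth by (simp add: inner_sum_right inner_commute)
    qed
    have rT: "inner r (x T) = (norm r)\<^sup>2"
    proof -
      have "inner r (x T) = inner r (r + (\<Sum>i<d. inner (e i) (x T) *\<^sub>R e i))"
        by (simp add: r_def)
      also have "\<dots> = inner r r"
        using orth by (simp add: inner_add_right inner_sum_right inner_commute)
      finally show ?thesis by (simp add: power2_norm_eq_inner)
    qed
    have "x t = (\<Sum>i<Suc d. inner (e' i) (x t) *\<^sub>R e' i)" if "t < Suc T" for t
    proof (cases "t = T")
      case True
      have "inner (e' d) (x T) *\<^sub>R e' d = r"
        using False by (simp add: e'_def rT power2_eq_square field_simps)
      then show ?thesis using True by (simp add: lt r_def)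
    next
      case False
      then have "t < T" using that by simp
      then show ?thesis using x[of t] rx[of t] by (simp add: lt e'_def)
    qed
    then show ?thesis using d e' by (meson Suc_le_mono)
  qed
qed

section \<open>Eigenvectors of f* f for a compact operator, by deflation\<close>

lemma norm_add_scaleR_square:
  fixes a b :: "'a::real_inner"
  shows "(norm (a + t *\<^sub>R b))\<^sup>2 = (norm a)\<^sup>2 + 2 * t * inner a b + t\<^sup>2 * (norm b)\<^sup>2"
  unfolding power2_norm_eq_inner
  by (simp add: inner_add_left inner_add_right inner_commute[of b a] power2_eq_square algebra_simps
      del: dot_square_norm)

text \<open>A maximising sequence is Cauchy along the subsequence on which the images converge, by the
  parallelogram law; no weak compactness and no adjoint is needed.\<close>
lemma compact_op_attains_norm:
  fixes f :: "'v::{real_inner,complete_space} \<Rightarrow> 'w::real_inner"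
  assumes f: "compact_op f" and M: "subspace M" "closed M" and x0: "x0 \<in> M" "x0 \<noteq> 0"
  obtains u where "u \<in> M" "norm u = 1" "\<And>x. x \<in> M \<Longrightarrow> norm (f x) \<le> norm (f u) * norm x"
proof -
  interpret f: bounded_linear f using f by (simp add: compact_op_def)
  define S where "S = M \<inter> sphere 0 1"
  define s where "s = (SUP x\<in>S. norm (f x))"
  have u0: "x0 /\<^sub>R norm x0 \<in> S" using x0 M by (auto simp: S_def subspace_scale)
  obtain B where B: "\<And>x. norm (f x) \<le> norm x * B" using f.bounded by blast
  have bdd: "bdd_above ((\<lambda>x. norm (f x)) ` S)"
  proof (rule bdd_aboveI2)
    show "norm (f x) \<le> B" if "x \<in> S" for x using B[of x] that by (simp add: S_def)
  qed
  have s_upper: "norm (f x) \<le> s" if "x \<in> S" for x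
    unfolding s_def using bdd that by (rule cSUP_upper2) simp
  have s: "norm (f x) \<le> s * norm x" if "x \<in> M" for x
  proof (cases "x = 0")
    case False
    then have "norm (f (x /\<^sub>R norm x)) \<le> s"
      using that M by (intro s_upper) (auto simp: S_def subspace_scale)
    then show ?thesis using False by (simp add: f.scale field_simps)
  qed (simp add: f.zero)
  show ?thesis
  proof (cases "s \<le> 0")
    \<comment> \<open>Here \<open>f\<close> vanishes on \<open>M\<close>, so any unit vector will
      do; the Cauchy argument of the other case divides by \<open>s\<close>.\<close>
    case True
    show ?thesis
    proof (rule that)
      show "x0 /\<^sub>R norm x0 \<in> M" "norm (x0 /\<^sub>R norm x0) = 1" using u0 by (auto simp: S_def)
      show "norm (f x) \<le> norm (f (x0 /\<^sub>R norm x0)) * norm x" if "x \<in> M" for x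
        using s[OF that] True by (smt (verit) mult_nonneg_nonneg mult_nonpos_nonneg norm_ge_zero)
    qed
  next
    case False
    have "\<exists>x. \<forall>n::nat. x n \<in> S \<and> s - 1 / real (Suc n) < norm (f (x n))"
    proof (rule choice, rule allI)
      fix n
      have "s - 1 / real (Suc n) < s" by simp
      then show "\<exists>x. x \<in> S \<and> s - 1 / real (Suc n) < norm (f x)"
        unfolding s_def using less_cSUP_iff[OF _ bdd] u0 by blast
    qed
    then obtain x where xS: "\<And>n. x n \<in> S" and xs: "\<And>n. s - 1 / real (Suc n) < norm (f (x n))"
      by blast
    have "f (x n) \<in> closure (f ` cball 0 1)" for n
      using xS by (intro closure_subset[THEN subsetD] imageI) (auto simp: S_def)
    moreover have "seq_compact (closure (f ` cball 0 1))"
      using f by (simp add: compact_op_def compact_eq_seq_compact_metric)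
    ultimately obtain l r where r: "strict_mono r" and l: "((\<lambda>n. f (x n)) \<circ> r) \<longlonglongrightarrow> l"
      using seq_compactE[of "closure (f ` cball 0 1)" "\<lambda>n. f (x n)"] by metis
    define a where "a = x \<circ> r"
    have aS: "a n \<in> S" for n using xS by (simp add: a_def)
    have fa: "(\<lambda>n. f (a n)) \<longlonglongrightarrow> l" using l by (simp add: a_def comp_def)
    have "(\<lambda>n. norm (f (a n))) \<longlonglongrightarrow> s"
    proof (rule real_tendsto_sandwich)
      have "(\<lambda>n. s - 1 / real (Suc n)) \<longlonglongrightarrow> s - 0"
        by (intro tendsto_diff tendsto_const LIMSEQ_Suc lim_1_over_n)
      from LIMSEQ_subseq_LIMSEQ[OF this r]
      show "(\<lambda>n. s - 1 / real (Suc (r n))) \<longlonglongrightarrow> s" by (simp add: comp_def)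
      show "\<forall>\<^sub>F n in sequentially. s - 1 / real (Suc (r n)) \<le> norm (f (a n))"
        using xs by (auto simp: a_def intro!: always_eventually less_imp_le)
      show "\<forall>\<^sub>F n in sequentially. norm (f (a n)) \<le> s"
        using s_upper aS by (auto intro!: always_eventually)
    qed simp
    then have nl: "norm l = s" using tendsto_norm[OF fa] LIMSEQ_unique by blast
    have "Cauchy a"
    proof (rule metric_CauchyI)
      fix \<epsilon> :: real assume \<epsilon>: "\<epsilon> > 0"
      \<comment> \<open>Chosen so that \<open>s * (2 - q) \<le> 2 * \<delta>\<close> gives
        \<open>2 - q \<le> \<epsilon>\<^sup>2 / 8\<close>; then \<open>4 - q\<^sup>2\<close>, at
        most four times that, stays below \<open>\<epsilon>\<^sup>2\<close>.\<close>
      define \<delta> where "\<delta> = s * \<epsilon>\<^sup>2 / 16"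
      have \<delta>: "\<delta> > 0" using False \<epsilon> by (simp add: \<delta>_def)
      then obtain N where N: "\<And>n. n \<ge> N \<Longrightarrow> norm (f (a n) - l) < \<delta>"
        using LIMSEQ_iff[of "\<lambda>n. f (a n)" l] fa by metis
      have "dist (a m) (a n) < \<epsilon>" if "m \<ge> N" "n \<ge> N" for m n
      proof -
        define q where "q = norm (a m + a n)"
        have na: "norm (a m) = 1" "norm (a n) = 1" "a m + a n \<in> M"
          using aS[of m] aS[of n] M by (auto simp: S_def subspace_add)
        have "norm (l + l) \<le> norm (f (a m) + f (a n)) + norm (f (a m) - l) + norm (f (a n) - l)"
          by (smt (verit) add_diff_add norm_minus_commute norm_triangle_ineq norm_triangle_sub)
        moreover have "norm (l + l) = 2 * s" using nl by (simp flip: scaleR_2)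
        moreover have "norm (f (a m) + f (a n)) \<le> s * q"
          using s[OF na(3)] by (simp add: q_def f.add)
        ultimately have "s * (2 - q) \<le> 2 * \<delta>" using N[OF that(1)] N[OF that(2)]
          by (simp add: algebra_simps)
        then have "s * (2 - q) \<le> s * (\<epsilon>\<^sup>2 / 8)" by (simp add: \<delta>_def)
        then have q: "2 - q \<le> \<epsilon>\<^sup>2 / 8" using False by simp
        have q2: "0 \<le> q" "q \<le> 2" using norm_triangle_ineq[of "a m" "a n"] na by (auto simp: q_def)
        have "(norm (a m - a n))\<^sup>2 = 4 - q\<^sup>2"
          using na norm_add_scaleR_square[of "a m" 1 "a n"] norm_add_scaleR_square[of "a m" "-1" "a n"]
          by (simp add: q_def)
        also have "\<dots> = (2 - q) * (2 + q)" by (simp add: power2_eq_square algebra_simps)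
        also have "\<dots> \<le> \<epsilon>\<^sup>2 / 8 * 4" using q q2 by (intro mult_mono) auto
        also have "\<dots> < \<epsilon>\<^sup>2" using \<epsilon> by simp
        finally show ?thesis using \<epsilon> by (auto simp: dist_norm intro: power2_less_imp_less)
      qed
      then show "\<exists>N. \<forall>m\<ge>N. \<forall>n\<ge>N. dist (a m) (a n) < \<epsilon>" by blast
    qed
    then obtain u where u: "a \<longlonglongrightarrow> u" using Cauchy_convergent_iff convergent_def by blast
    show ?thesis
    proof (rule that)
      show "u \<in> M" using M(2) u aS closed_sequentially[of M a u] by (auto simp: S_def)
      have "(\<lambda>n. norm (a n)) \<longlonglongrightarrow> norm u" using u by (rule tendsto_norm)
      moreover have "norm (a n) = 1" for n using aS[of n] by (simp add: S_def)
      ultimately have "(\<lambda>n. 1) \<longlonglongrightarrow> norm u" by simp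
      then show "norm u = 1" by (simp add: LIMSEQ_const_iff)
      have "(\<lambda>n. f (a n)) \<longlonglongrightarrow> f u" using u by (rule f.tendsto)
      then have "norm (f u) = s" using fa nl LIMSEQ_unique by blast
      then show "norm (f x) \<le> norm (f u) * norm x" if "x \<in> M" for x using s[OF that] by simp
    qed
  qed
qed

text \<open>First-order condition along the lines \<open>u + t *\<^sub>R x\<close>, which stay in
  \<open>M\<close>: comparing squared norms leaves a quadratic inequality in \<open>t\<close>, whose
  linear coefficient must vanish.\<close>

lemma maximiser_eigen_equation:
  fixes f :: "'v::real_inner \<Rightarrow> 'w::real_inner"
  assumes f: "linear f" and M: "subspace M" and u: "u \<in> M" "norm u = 1"
    and max: "\<And>x. x \<in> M \<Longrightarrow> norm (f x) \<le> norm (f u) * norm x" and x: "x \<in> M"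
  shows "inner (f u) (f x) = (norm (f u))\<^sup>2 * inner u x"
proof -
  define b where "b = inner (f u) (f x) - (norm (f u))\<^sup>2 * inner u x"
  define C where "C = (norm (f u))\<^sup>2 * (norm x)\<^sup>2 - (norm (f x))\<^sup>2"
  have "(norm (f x))\<^sup>2 \<le> (norm (f u) * norm x)\<^sup>2" using max[OF x] by (intro power_mono) auto
  then have C: "C \<ge> 0" by (simp add: C_def power_mult_distrib)
  have ineq: "2 * t * b \<le> t\<^sup>2 * C" for t
  proof -
    have "norm (f (u + t *\<^sub>R x)) \<le> norm (f u) * norm (u + t *\<^sub>R x)"
      using M u x by (intro max subspace_add subspace_scale)
    then have "(norm (f (u + t *\<^sub>R x)))\<^sup>2 \<le> (norm (f u) * norm (u + t *\<^sub>R x))\<^sup>2"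
      by (intro power_mono) auto
    moreover have "(norm (f (u + t *\<^sub>R x)))\<^sup>2
        = (norm (f u))\<^sup>2 + 2 * t * inner (f u) (f x) + t\<^sup>2 * (norm (f x))\<^sup>2"
      using f by (simp add: linear_add linear_scale norm_add_scaleR_square)
    moreover have "(norm (u + t *\<^sub>R x))\<^sup>2 = (norm u)\<^sup>2 + 2 * t * inner u x + t\<^sup>2 * (norm x)\<^sup>2"
      by (rule norm_add_scaleR_square)
    ultimately show ?thesis using u(2) by (simp add: b_def C_def power_mult_distrib algebra_simps)
  qed
  \<comment> \<open>The \<open>t\<close> to insert: small enough for the linear term to dominate,
    with \<open>C + 1\<close> avoiding a division by zero when \<open>C = 0\<close>.\<close>
  define q where "q = b / (C + 1)"
  have b: "b = q * (C + 1)" using C by (simp add: q_def)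
  have "2 * q * b * (C + 1)\<^sup>2 \<le> q\<^sup>2 * C * (C + 1)\<^sup>2"
    by (intro mult_right_mono ineq) auto
  then have "2 * b\<^sup>2 * (C + 1) \<le> b\<^sup>2 * C"
    unfolding b by (simp add: power2_eq_square mult_ac)
  then have "b\<^sup>2 * (C + 2) \<le> 0" by (simp add: algebra_simps)
  then have "b = 0" using C
    by (metis add_nonneg_pos mult_le_0_iff not_less power2_less_eq_zero_iff zero_less_numeral)
  then show ?thesis by (simp add: b_def)
qed

text \<open>The eigenvalues are written \<open>(norm (f (u i)))\<^sup>2\<close>, so no adjoint
  appears. The last clause is the induction invariant: it keeps the next eigenvalue below the
  earlier ones, and its inner quantifier makes it vacuous for \<open>n = 0\<close>.\<close>

definition leading_eigensystem ::
  "('a::real_inner \<Rightarrow> 'b::real_inner) \<Rightarrow> nat \<Rightarrow> (nat \<Rightarrow> 'a) \<Rightarrow> bool" where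
  "leading_eigensystem f n u \<longleftrightarrow> orthonormal_upto n u
    \<and> (\<forall>i<n. \<forall>x. inner (f (u i)) (f x) = (norm (f (u i)))\<^sup>2 * inner (u i) x)
    \<and> (\<forall>j<n. \<forall>i\<le>j. norm (f (u j)) \<le> norm (f (u i)))
    \<and> (\<forall>x. (\<forall>i<n. inner (u i) x = 0) \<longrightarrow> (\<forall>i<n. norm (f x) \<le> norm (f (u i)) * norm x))"

lemma leading_eigensystemD:
  assumes "leading_eigensystem f n u"
  shows "orthonormal_upto n u"
    and "\<And>i x. i < n \<Longrightarrow> inner (f (u i)) (f x) = (norm (f (u i)))\<^sup>2 * inner (u i) x"
    and "\<And>i j. j < n \<Longrightarrow> i \<le> j \<Longrightarrow> norm (f (u j)) \<le> norm (f (u i))"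
    and "\<And>x i. \<forall>i<n. inner (u i) x = 0 \<Longrightarrow> i < n \<Longrightarrow> norm (f x) \<le> norm (f (u i)) * norm x"
  using assms unfolding leading_eigensystem_def by simp_all

text \<open>The next eigenvector maximises \<open>norm (f x)\<close> over unit vectors orthogonal to
  those already found; infinite dimension ensures that this orthogonal complement is not
  zero.\<close>

lemma compact_op_eigenvectors:
  fixes f :: "'v::{real_inner,complete_space} \<Rightarrow> 'w::real_inner"
  assumes f: "compact_op f" and inf: "\<not> (\<exists>B::'v set. finite B \<and> span B = UNIV)"
  shows "\<exists>u. leading_eigensystem f n u"
proof (induction n)
  case 0
  show ?case by (auto simp: leading_eigensystem_def orthonormal_upto_def)
next
  case (Suc n)
  interpret f: bounded_linear f using f by (simp add: compact_op_def)
  from Suc obtain u where "leading_eigensystem f n u" by blast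
  note u = leading_eigensystemD(1)[OF this] and eig = leading_eigensystemD(2)[OF this]
    and dec = leading_eigensystemD(3)[OF this] and bound = leading_eigensystemD(4)[OF this]
  define M where "M = {x. \<forall>i<n. inner (u i) x = 0}"
  have M: "subspace M" by (auto simp: M_def subspace_def inner_add_right)
  have "M = (\<Inter>i\<in>{..<n}. {x. inner (u i) x = 0})" by (auto simp: M_def)
  then have clM: "closed M" by (auto intro!: closed_INT closed_Collect_eq continuous_intros)
  define R where "R x = x - (\<Sum>i<n. inner (u i) x *\<^sub>R u i)" for x
  have RM: "R x \<in> M" for x
    unfolding M_def R_def using orthonormal_upto_residual[OF u] by blast
  obtain y where y: "y \<notin> span (u ` {..<n})" using inf by blast
  have "R y \<noteq> 0"
  proof
    assume "R y = 0"
    then have "y = (\<Sum>i<n. inner (u i) y *\<^sub>R u i)" by (simp add: R_def)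
    also have "\<dots> \<in> span (u ` {..<n})" by (intro span_sum span_scale span_base) auto
    finally show False using y by contradiction
  qed
  with RM obtain v where v: "v \<in> M" "norm v = 1"
    and vmax: "\<And>x. x \<in> M \<Longrightarrow> norm (f x) \<le> norm (f v) * norm x"
    using compact_op_attains_norm[OF f M clM] by metis
  have veigM: "inner (f v) (f x) = (norm (f v))\<^sup>2 * inner v x" if "x \<in> M" for x
    using maximiser_eigen_equation[OF f.linear M v vmax that] by blast
  have vu: "inner v (u i) = 0" if "i < n" for i using v that by (simp add: M_def inner_commute)
  have fvu: "inner (f v) (f (u i)) = 0" if "i < n" for i
    using eig[OF that, of v] vu[OF that] by (simp add: inner_commute)
  \<comment> \<open>Maximality gives the equation on \<open>M\<close> only. It extends to the whole
    space because \<open>f v\<close> is orthogonal to each \<open>f (u i)\<close>, by the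
    eigen-equation of \<open>u i\<close>.\<close>
  have veig: "inner (f v) (f x) = (norm (f v))\<^sup>2 * inner v x" for x
  proof -
    have x: "x = (\<Sum>i<n. inner (u i) x *\<^sub>R u i) + R x" by (simp add: R_def)
    have "inner (f v) (f x) = inner (f v) (f (R x))"
      by (subst x) (simp add: f.add f.sum f.scale inner_add_right inner_sum_right fvu)
    also have "\<dots> = (norm (f v))\<^sup>2 * inner v (R x)" by (rule veigM[OF RM])
    also have "inner v (R x) = inner v x"
      by (simp add: R_def inner_diff_right inner_sum_right vu)
    finally show ?thesis .
  qed
  define u' where "u' = u(n := v)"
  have u'n: "u' n = v" and u'i: "\<And>i. i < n \<Longrightarrow> u' i = u i" by (auto simp: u'_def)
  have fvle: "norm (f v) \<le> norm (f (u i))" if "i < n" for i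
    using bound[of v i] v that by (simp add: M_def)
  have "leading_eigensystem f (Suc n) u'"
    unfolding leading_eigensystem_def
  proof (intro conjI)
    show "orthonormal_upto (Suc n) u'"
    proof (rule orthonormal_upto_Suc)
      show "orthonormal_upto n u'" using u u'i by (subst orthonormal_upto_cong[of n u' u]) auto
    qed (use v in \<open>auto simp: u'n u'i M_def\<close>)
    show "\<forall>i<Suc n. \<forall>x. inner (f (u' i)) (f x) = (norm (f (u' i)))\<^sup>2 * inner (u' i) x"
      using eig veig by (auto simp: less_Suc_eq u'n u'i)
    show "\<forall>j<Suc n. \<forall>i\<le>j. norm (f (u' j)) \<le> norm (f (u' i))"
    proof (intro allI impI)
      fix i j assume "j < Suc n" "i \<le> j"
      then consider "j < n" "i < n" | "j = n" "i < n" | "j = n" "i = n" by linarith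
      then show "norm (f (u' j)) \<le> norm (f (u' i))"
        by cases (use dec[of j i] fvle \<open>i \<le> j\<close> in \<open>auto simp: u'n u'i\<close>)
    qed
    show "\<forall>x. (\<forall>i<Suc n. inner (u' i) x = 0) \<longrightarrow>
        (\<forall>i<Suc n. norm (f x) \<le> norm (f (u' i)) * norm x)"
    proof (intro allI impI)
      fix x i assume orth: "\<forall>i<Suc n. inner (u' i) x = 0" and i: "i < Suc n"
      then have "x \<in> M" by (auto simp: M_def u'i less_Suc_eq)
      then show "norm (f x) \<le> norm (f (u' i)) * norm x"
        using i vmax bound by (auto simp: less_Suc_eq u'n u'i M_def)
    qed
  qed
  then show ?case by blast
qed

section \<open>Lower bounds for singular values and Ky Fan's inequality\<close>

lemma sing_val_ge:
  fixes f :: "'v::real_inner \<Rightarrow> 'w::real_inner"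
  assumes f: "bounded_linear f" and e: "orthonormal_upto (Suc n) e"
    and eig: "\<And>i x. i \<le> n \<Longrightarrow> inner (f (e i)) (f x) = (norm (f (e i)))\<^sup>2 * inner (e i) x"
    and ge: "\<And>i. i \<le> n \<Longrightarrow> l \<le> norm (f (e i))" and l: "0 \<le> l"
  shows "l \<le> sing_val f (Suc n)"
proof -
  interpret f: bounded_linear f by fact
  define S where "S = {t. \<exists>e::nat \<Rightarrow> 'v.
      (\<forall>i<Suc n. \<forall>j<Suc n. inner (e i) (e j) = (if i = j then 1 else 0)) \<and>
      (\<forall>i<Suc n. \<exists>mu\<ge>t. \<forall>x. inner (f (e i)) (f x) = mu * inner (e i) x)}"
  \<comment> \<open>A real \<open>Sup\<close> is informative only for a set bounded above: an
    admissible \<open>t\<close> is at most an eigenvalue of f* f, hence at most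
    \<open>B\<^sup>2\<close>.\<close>
  obtain B where B: "\<And>x. norm (f x) \<le> norm x * B" using f.bounded by blast
  have "t \<le> B\<^sup>2" if "t \<in> S" for t
  proof -
    from that obtain e :: "nat \<Rightarrow> 'v" and mu where "inner (e 0) (e 0) = 1" "t \<le> mu"
      and e: "inner (f (e 0)) (f (e 0)) = mu * inner (e 0) (e 0)"
      unfolding S_def by (fastforce dest: spec[of _ 0])
    then have "t \<le> (norm (f (e 0)))\<^sup>2" and "norm (e 0) = 1"
      by (auto simp: power2_norm_eq_inner norm_eq_sqrt_inner)
    moreover have "(norm (f (e 0)))\<^sup>2 \<le> B\<^sup>2"
      using B[of "e 0"] \<open>norm (e 0) = 1\<close> by (intro power_mono) auto
    ultimately show ?thesis by linarith
  qed
  then have bdd: "bdd_above ({0} \<union> S)" by (auto intro!: bdd_aboveI[of S "B\<^sup>2"])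
  have "l\<^sup>2 \<in> S"
    unfolding S_def
  proof (intro CollectI exI[of _ e] conjI allI impI)
    fix i assume "i < Suc n"
    then show "\<exists>mu\<ge>l\<^sup>2. \<forall>x. inner (f (e i)) (f x) = mu * inner (e i) x"
      using eig[of i] ge[of i] l by (intro exI[of _ "(norm (f (e i)))\<^sup>2"]) (auto intro: power_mono)
  qed (use e in \<open>auto simp: orthonormal_upto_def\<close>)
  then have "l\<^sup>2 \<le> Sup ({0} \<union> S)" using bdd by (intro cSup_upper) auto
  then show ?thesis unfolding sing_val_def S_def[symmetric] using l real_le_rsqrt by blast
qed

text \<open>The \<open>0\<close> inside the \<open>Sup\<close> helps only once the set is known to
  be bounded; \<open>sing_val_ge\<close> at level \<open>0\<close> takes care of that.\<close>

lemma sing_val_nonneg: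
  fixes f :: "'v::{real_inner,complete_space} \<Rightarrow> 'w::real_inner"
  assumes f: "compact_op f" and inf: "\<not> (\<exists>B::'v set. finite B \<and> span B = UNIV)"
  shows "0 \<le> sing_val f (Suc n)"
proof -
  obtain u where u: "leading_eigensystem f (Suc n) u"
    using compact_op_eigenvectors[OF f inf] by blast
  show ?thesis
    using f leading_eigensystemD(1,2)[OF u]
    by (intro sing_val_ge[of f n u]) (auto simp: compact_op_def)
qed

text \<open>Ky Fan's inequality. Splitting off only the first \<open>d\<close> eigenvectors suffices, so the full singular
  value decomposition is not needed.\<close>
lemma sum_norm_orthonormal_le_sing_val:
  fixes f :: "'v::{real_inner,complete_space} \<Rightarrow> 'w::real_inner"
  assumes f: "compact_op f" and inf: "\<not> (\<exists>B::'v set. finite B \<and> span B = UNIV)"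
    and e: "orthonormal_upto d e"
  shows "(\<Sum>i<d. (norm (f (e i)))\<^sup>2) \<le> (\<Sum>n<d. (sing_val f (Suc n))\<^sup>2)"
proof (cases "d = 0")
  case False
  interpret f: bounded_linear f using f by (simp add: compact_op_def)
  obtain u where "leading_eigensystem f d u"
    using compact_op_eigenvectors[OF f inf] by blast
  note u = leading_eigensystemD(1)[OF this] and eig = leading_eigensystemD(2)[OF this]
    and dec = leading_eigensystemD(3)[OF this] and bound = leading_eigensystemD(4)[OF this]
  define lam where "lam n = (norm (f (u n)))\<^sup>2" for n
  define mu where "mu = lam (d - 1)"
  define a where "a n = (\<Sum>i<d. (inner (u n) (e i))\<^sup>2)" for n
  have mu: "mu \<le> lam n" if "n < d" for n
    unfolding mu_def lam_def using that by (intro power_mono dec) auto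
  have a: "a n \<le> 1" if "n < d" for n
    using orthonormal_upto_Bessel[OF e, of "u n"] orthonormal_upto_norm[OF u that]
    by (simp add: a_def inner_commute)
  have lam: "lam n \<le> (sing_val f (Suc n))\<^sup>2" if "n < d" for n
    unfolding lam_def
  proof (intro power_mono sing_val_ge)
    show "orthonormal_upto (Suc n) u" using u that by (intro orthonormal_upto_mono[OF u]) auto
  qed (use that in \<open>auto intro: eig dec f.bounded_linear_axioms\<close>)
  \<comment> \<open>As quadratic forms, f* f is its leading part plus a remainder of at most
    \<open>mu\<close> on the orthogonal complement of the \<open>u n\<close>. Subtracting
    \<open>mu\<close> on their span and adding it everywhere gives this shape.\<close>
  have *: "(norm (f x))\<^sup>2 \<le> (\<Sum>n<d. (lam n - mu) * (inner (u n) x)\<^sup>2) + mu * (norm x)\<^sup>2" for x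
  proof -
    define r where "r = x - (\<Sum>i<d. inner (u i) x *\<^sub>R u i)"
    have x: "f x = (\<Sum>i<d. inner (u i) x *\<^sub>R f (u i)) + f r"
      by (simp add: r_def f.diff f.sum f.scale)
    have ur: "inner (u i) r = 0" if "i < d" for i
      unfolding r_def using that by (rule orthonormal_upto_residual[OF u])
    have "inner (f r) (f (u i)) = 0" if "i < d" for i
      using eig[OF that, of r] ur[OF that] by (simp add: inner_commute)
    then have "inner (f r) (f x) = inner (f r) (f r)"
      by (subst x) (simp add: inner_add_right inner_sum_right)
    moreover have "inner (f x) (f x) = (\<Sum>i<d. lam i * (inner (u i) x)\<^sup>2) + inner (f r) (f x)"
    proof -
      have "inner (f x) (f x) = (\<Sum>i<d. inner (u i) x * inner (f (u i)) (f x)) + inner (f r) (f x)"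
        by (subst (1) x) (simp add: inner_add_left inner_sum_left)
      then show ?thesis by (simp add: eig lam_def power2_eq_square algebra_simps)
    qed
    ultimately have "(norm (f x))\<^sup>2 = (\<Sum>i<d. lam i * (inner (u i) x)\<^sup>2) + (norm (f r))\<^sup>2"
      by (simp add: power2_norm_eq_inner)
    moreover have "(norm (f r))\<^sup>2 \<le> mu * (norm r)\<^sup>2"
      using bound[of r "d - 1"] ur False
      by (auto simp: mu_def lam_def intro!: power_mono simp flip: power_mult_distrib)
    moreover have "(norm r)\<^sup>2 = (norm x)\<^sup>2 - (\<Sum>i<d. (inner (u i) x)\<^sup>2)"
      using orthonormal_upto_Pythagoras[OF u, of x] by (simp add: r_def)
    ultimately show ?thesis
      by (simp add: algebra_simps sum_subtractf sum_distrib_left)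
  qed
  have "(\<Sum>i<d. (norm (f (e i)))\<^sup>2)
      \<le> (\<Sum>i<d. (\<Sum>n<d. (lam n - mu) * (inner (u n) (e i))\<^sup>2) + mu)"
  proof (rule sum_mono)
    fix i assume "i \<in> {..<d}"
    then show "(norm (f (e i)))\<^sup>2 \<le> (\<Sum>n<d. (lam n - mu) * (inner (u n) (e i))\<^sup>2) + mu"
      using *[of "e i"] orthonormal_upto_norm[OF e] by simp
  qed
  also have "\<dots> = (\<Sum>n<d. (lam n - mu) * a n + mu)"
    unfolding sum.distrib a_def sum_distrib_left by (subst sum.swap) simp
  \<comment> \<open>The shift by \<open>mu\<close> makes the coefficients nonnegative, so each
    \<open>a n\<close> may be raised to its Bessel bound; the \<open>d\<close> copies of
    \<open>mu\<close> then restore the \<open>lam n\<close>.\<close>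
  also have "\<dots> \<le> (\<Sum>n<d. (lam n - mu) * 1 + mu)"
    using mu a by (intro sum_mono add_mono mult_left_mono) auto
  also have "\<dots> \<le> (\<Sum>n<d. (sing_val f (Suc n))\<^sup>2)" using lam by (intro sum_mono) simp
  finally show ?thesis .
qed simp

section \<open>From Schatten norms to Hilbert--Schmidt norms in dimension \<open>d\<close>\<close>

lemma power2_le_powr_Young:
  fixes s \<theta> r :: real
  assumes "s \<ge> 0" "\<theta> > 0" "r > 2"
  shows "s\<^sup>2 \<le> (2 / r) * s powr r * \<theta> powr (2 - r) + (1 - 2 / r) * \<theta>\<^sup>2"
proof (cases "s = 0")
  case False
  with assms have s: "s > 0" by simp
  \<comment> \<open>Young's inequality with weights \<open>2 / r\<close> and
    \<open>1 - 2 / r\<close>; the factors are balanced so that \<open>\<theta>\<close> cancels in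
    the product. Equality holds at \<open>s = \<theta>\<close>.\<close>
  have "(s powr r * \<theta> powr (2 - r)) powr (2 / r) * (\<theta>\<^sup>2) powr (1 - 2 / r)
      \<le> (2 / r) * (s powr r * \<theta> powr (2 - r)) + (1 - 2 / r) * \<theta>\<^sup>2"
    using assms s by (intro Youngs_inequality_0) (auto simp: field_simps)
  moreover have "(s powr r * \<theta> powr (2 - r)) powr (2 / r) * (\<theta>\<^sup>2) powr (1 - 2 / r) = s\<^sup>2"
  proof -
    have "(s powr r * \<theta> powr (2 - r)) powr (2 / r) = s powr 2 * \<theta> powr ((2 - r) * (2 / r))"
      using assms s by (simp add: powr_mult powr_powr)
    moreover have "(\<theta>\<^sup>2) powr (1 - 2 / r) = \<theta> powr (2 * (1 - 2 / r))"
      using assms by (simp add: powr_powr flip: powr_numeral)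
    moreover have "\<theta> powr ((2 - r) * (2 / r)) * \<theta> powr (2 * (1 - 2 / r)) = 1"
    proof -
      have "(2 - r) * (2 / r) + 2 * (1 - 2 / r) = 0" using assms by (simp add: field_simps)
      then show ?thesis using assms by (simp flip: powr_add)
    qed
    ultimately show ?thesis using s by simp
  qed
  ultimately show ?thesis by (simp add: mult.assoc)
qed (use assms in auto)

lemma sum_power2_le_of_sum_powr:
  fixes s :: "nat \<Rightarrow> real"
  assumes s: "\<And>n. n < d \<Longrightarrow> 0 \<le> s n" and c: "c > 0" and r: "r \<ge> 1"
    and sum: "(\<Sum>n<d. s n powr r) \<le> c powr r"
  shows "(\<Sum>n<d. (s n)\<^sup>2) \<le> c\<^sup>2 * real d powr max 0 (1 - 2 / r)"
proof (cases "d = 0")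
  case False
  show ?thesis
  proof (cases "r \<le> 2")
    case True
    \<comment> \<open>No term exceeds \<open>c\<close>, so the surplus power \<open>2 - r\<close> is
      traded for one of \<open>c\<close>, without any factor of the dimension.\<close>
    have "(s n)\<^sup>2 \<le> s n powr r * c powr (2 - r)" if n: "n < d" for n
    proof (cases "s n = 0")
      case False
      then have pos: "s n > 0" using s[OF n] by simp
      have "s n powr r \<le> (\<Sum>n<d. s n powr r)" by (rule member_le_sum) (use n in auto)
      then have "s n powr r \<le> c powr r" using sum by linarith
      then have "s n \<le> c" using c r pos powr_less_mono2[of r c "s n"] by fastforce
      then have "s n powr r * s n powr (2 - r) \<le> s n powr r * c powr (2 - r)"
        using True pos by (intro mult_left_mono powr_mono2) auto
      then show ?thesis using pos by (simp flip: powr_add)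
    qed simp
    then have "(\<Sum>n<d. (s n)\<^sup>2) \<le> (\<Sum>n<d. s n powr r * c powr (2 - r))" by (intro sum_mono) auto
    also have "\<dots> \<le> c powr r * c powr (2 - r)"
      unfolding sum_distrib_right[symmetric] using sum by (intro mult_right_mono) auto
    also have "\<dots> = c\<^sup>2" using c by (simp flip: powr_add)
    finally show ?thesis using True r False by (simp add: max_def field_simps)
  next
    case r2: False
    \<comment> \<open>The extremal configuration: \<open>d\<close> equal terms
      \<open>\<theta>\<close> have \<open>r\<close>-th powers summing to \<open>c powr r\<close>.
      Young's inequality is tight there, and both of its terms become multiples of
      \<open>c\<^sup>2 * E\<close>.\<close>
    define \<theta> where "\<theta> = c * real d powr (- 1 / r)"
    have \<theta>: "\<theta> > 0" using c False by (simp add: \<theta>_def)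
    define E where "E = real d powr (1 - 2 / r)"
    have \<theta>1: "c powr r * \<theta> powr (2 - r) = c\<^sup>2 * E"
    proof -
      have "- 1 / r * (2 - r) = 1 - 2 / r" using r by (simp add: field_simps)
      then have "\<theta> powr (2 - r) = c powr (2 - r) * E"
        unfolding \<theta>_def E_def using c by (simp add: powr_mult powr_powr)
      then show ?thesis using c by (simp flip: powr_add mult.assoc)
    qed
    have \<theta>2: "real d * \<theta>\<^sup>2 = c\<^sup>2 * E"
    proof -
      have "(real d powr (- 1 / r))\<^sup>2 = real d powr (- 2 / r)"
        by (simp add: power2_eq_square flip: powr_add)
      moreover have "real d * real d powr (- 2 / r) = E"
        unfolding E_def using powr_add[of "real d" 1 "- 2 / r"] False by simp
      ultimately show ?thesis by (simp add: \<theta>_def power_mult_distrib)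
    qed
    have "(\<Sum>n<d. (s n)\<^sup>2)
        \<le> (\<Sum>n<d. (2 / r) * s n powr r * \<theta> powr (2 - r) + (1 - 2 / r) * \<theta>\<^sup>2)"
      using s \<theta> r2 by (intro sum_mono power2_le_powr_Young) auto
    also have "\<dots> = (2 / r) * ((\<Sum>n<d. s n powr r) * \<theta> powr (2 - r)) + (1 - 2 / r) * (real d * \<theta>\<^sup>2)"
      by (simp add: sum.distrib sum_distrib_left sum_distrib_right mult_ac)
    also have "\<dots> \<le> (2 / r) * (c powr r * \<theta> powr (2 - r)) + (1 - 2 / r) * (real d * \<theta>\<^sup>2)"
      using sum r by (intro add_right_mono mult_left_mono mult_right_mono) auto
    also have "\<dots> = c\<^sup>2 * E" unfolding \<theta>1 \<theta>2 by (simp add: algebra_simps)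
    finally show ?thesis using r2 by (simp add: E_def max_def field_simps)
  qed
qed simp

text \<open>For finite \<open>p\<close>, \<open>2 * schatten_exponent p - 1\<close> is max 0 (1 -
  2/p), the growth rate in the dimension of the squared Hilbert--Schmidt norm; for infinite
  \<open>p\<close> it is 1.\<close>

definition schatten_exponent :: "ereal \<Rightarrow> real" where
  "schatten_exponent p = (if p = \<infinity> then 1 else max (1/2) (1 - 1 / real_of_ereal p))"

lemma schatten_ball_sum_norm_orthonormal:
  fixes f :: "'v::{real_inner,complete_space} \<Rightarrow> 'w::real_inner"
  assumes inf: "\<not> (\<exists>B::'v set. finite B \<and> span B = UNIV)"
    and f: "f \<in> schatten_ball p c" and c: "c > 0" and p: "p \<ge> 1" and e: "orthonormal_upto d e"
  shows "(\<Sum>i<d. (norm (f (e i)))\<^sup>2) \<le> c\<^sup>2 * real d powr (2 * schatten_exponent p - 1)"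
proof -
  have cf: "compact_op f" and pf: "schatten_norm p f \<le> ereal c"
    using f by (auto simp: schatten_ball_def)
  let ?s = "\<lambda>n. sing_val f (Suc n)"
  have s: "0 \<le> ?s n" for n using cf inf by (rule sing_val_nonneg)
  have "(\<Sum>n<d. (?s n)\<^sup>2) \<le> c\<^sup>2 * real d powr (2 * schatten_exponent p - 1)"
  proof (cases p)
    case PInf
    have "?s n \<le> c" for n
      using pf PInf SUP_upper[of n UNIV "\<lambda>n. ereal (?s n)"]
      by (simp add: schatten_norm_def) (metis ereal_less_eq(3) order_trans)
    then have "(\<Sum>n<d. (?s n)\<^sup>2) \<le> (\<Sum>n<d. c\<^sup>2)" using s by (intro sum_mono power_mono)
    then show ?thesis using PInf by (simp add: schatten_exponent_def mult.commute)
  next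
    case (real r)
    then have r: "r \<ge> 1" using p by simp
    have summ: "summable (\<lambda>n. ?s n powr r)" and le: "(\<Sum>n. ?s n powr r) powr (1 / r) \<le> c"
      using pf real by (auto simp: schatten_norm_def split: if_splits)
    have nonneg: "0 \<le> (\<Sum>n. ?s n powr r)" using summ by (intro suminf_nonneg) auto
    have "(\<Sum>n<d. ?s n powr r) \<le> (\<Sum>n. ?s n powr r)"
      using summ by (intro sum_le_suminf) auto
    also have "\<dots> = ((\<Sum>n. ?s n powr r) powr (1 / r)) powr r"
      using nonneg r by (simp add: powr_powr)
    also have "\<dots> \<le> c powr r" using le r by (intro powr_mono2) auto
    finally have "(\<Sum>n<d. (?s n)\<^sup>2) \<le> c\<^sup>2 * real d powr max 0 (1 - 2 / r)"
      using s c r by (intro sum_power2_le_of_sum_powr)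
    moreover have "max 0 (1 - 2 / r) = 2 * schatten_exponent p - 1"
      using real by (simp add: schatten_exponent_def max_def)
    ultimately show ?thesis by simp
  qed (use p in simp)
  then show ?thesis using sum_norm_orthonormal_le_sing_val[OF cf inf e] by linarith
qed

text \<open>The previous bound for an orthonormal system of one vector, where the dimension factor
  is a power of 1.\<close>

lemma schatten_ball_norm_le:
  fixes f :: "'v::{real_inner,complete_space} \<Rightarrow> 'w::real_inner"
  assumes inf: "\<not> (\<exists>B::'v set. finite B \<and> span B = UNIV)"
    and f: "f \<in> schatten_ball p c" and c: "c > 0" and p: "p \<ge> 1"
  shows "norm (f x) \<le> c * norm x"
proof (cases "x = 0")
  case False
  have lin: "linear f"
    using f by (simp add: schatten_ball_def compact_op_def bounded_linear.linear)
  have "(norm (f (x /\<^sub>R norm x)))\<^sup>2 \<le> c\<^sup>2"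
    using schatten_ball_sum_norm_orthonormal[OF inf f c p, of 1 "\<lambda>_. x /\<^sub>R norm x"] False
    by (simp add: orthonormal_upto_def power2_eq_square field_simps flip: power2_norm_eq_inner)
  then have "norm (f (x /\<^sub>R norm x)) \<le> c" using c by (auto intro: power2_le_imp_le)
  then show ?thesis using False by (simp add: linear_scale[OF lin] field_simps)
qed (use f in \<open>simp add: schatten_ball_def compact_op_def bounded_linear.linear linear_0\<close>)

text \<open>Provides nonemptiness for the suprema and infima over the ball. Testing the
  eigen-equation of the zero map on a unit eigenvector forces \<open>mu = 0\<close>.\<close>

lemma zero_in_schatten_ball:
  assumes "c > 0" and "p \<ge> 1"
  shows "(\<lambda>_. 0) \<in> schatten_ball p c"
proof -
  have [simp]: "sing_val (\<lambda>_::'a. 0::'b) (Suc n) = 0" for n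
  proof -
    define S where "S = {t. \<exists>e::nat \<Rightarrow> 'a.
      (\<forall>i<Suc n. \<forall>j<Suc n. inner (e i) (e j) = (if i = j then 1 else 0)) \<and>
      (\<forall>i<Suc n. \<exists>mu\<ge>t. \<forall>x. inner (0::'b) 0 = mu * inner (e i) x)}"
    have "t \<le> 0" if "t \<in> S" for t
    proof -
      from that obtain e :: "nat \<Rightarrow> 'a" and mu where "inner (e 0) (e 0) = 1" "t \<le> mu"
        and "inner (0::'b) 0 = mu * inner (e 0) (e 0)"
        unfolding S_def by (fastforce dest: spec[of _ 0])
      then show ?thesis by simp
    qed
    then have "Sup ({0} \<union> S) = 0" by (intro cSup_eq_maximum) auto
    then show ?thesis unfolding sing_val_def S_def by simp
  qed
  have "compact_op (\<lambda>_::'a. 0::'b)"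
    by (auto simp: compact_op_def image_constant_conv)
  moreover have "schatten_norm p (\<lambda>_::'a. 0::'b) \<le> ereal c"
    using assms by (simp add: schatten_norm_def)
  ultimately show ?thesis by (simp add: schatten_ball_def)
qed

section \<open>Rademacher bound for Schatten balls\<close>

lemma finite_bool_lists [simp]: "finite {\<sigma>::bool list. length \<sigma> = n}"
  using finite_lists_length_eq[of "UNIV :: bool set" n] by simp

lemma card_bool_lists [simp]: "card {\<sigma>::bool list. length \<sigma> = n} = 2 ^ n"
  using card_lists_length_eq[of "UNIV :: bool set" n] by simp

text \<open>Flipping the t-th sign is an involution that negates each summand.\<close>
lemma sum_sign_eq_0:
  fixes g :: "bool list \<Rightarrow> real"
  assumes "t < n" and g: "\<And>\<sigma>. length \<sigma> = n \<Longrightarrow> g (\<sigma>[t := \<not> \<sigma> ! t]) = g \<sigma>"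
  shows "(\<Sum>\<sigma> | length \<sigma> = n. (if \<sigma> ! t then 1 else -1) * g \<sigma>) = 0"
proof -
  let ?h = "\<lambda>\<sigma>. (if \<sigma> ! t then 1 else -1) * g \<sigma>"
  have "(\<Sum>\<sigma> | length \<sigma> = n. ?h \<sigma>) = (\<Sum>\<sigma> | length \<sigma> = n. - ?h \<sigma>)"
    by (rule sum.reindex_bij_witness[where i = "\<lambda>\<sigma>. \<sigma>[t := \<not> \<sigma> ! t]" and j = "\<lambda>\<sigma>. \<sigma>[t := \<not> \<sigma> ! t]"])
       (use assms in auto)
  then show ?thesis by (simp add: sum_negf)
qed

lemma sum_sign_predictable_eq_0:
  fixes g :: "bool list \<Rightarrow> real"
  assumes "t < n"
  shows "(\<Sum>\<sigma> | length \<sigma> = n. (if \<sigma> ! t then 1 else -1) * g (take t \<sigma>)) = 0"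
  using assms by (intro sum_sign_eq_0) auto

text \<open>Orthogonality of martingale differences: off the diagonal, the later of the two signs is
  seen neither by \<open>g\<close> nor by the other sign, so the term averages to zero.\<close>

lemma sum_sign_double_predictable:
  fixes g :: "nat \<Rightarrow> nat \<Rightarrow> bool list \<Rightarrow> real"
  assumes sym: "\<And>s t \<sigma>. g s t \<sigma> = g t s \<sigma>"
    and g: "\<And>s t \<sigma> \<sigma>'. s \<le> t \<Longrightarrow> take t \<sigma> = take t \<sigma>' \<Longrightarrow> g s t \<sigma> = g s t \<sigma>'"
  shows "(\<Sum>\<sigma> | length \<sigma> = n. \<Sum>s<n. \<Sum>t<n.
      (if \<sigma> ! s then 1 else -1) * (if \<sigma> ! t then 1 else -1) * g s t \<sigma>)
    = (\<Sum>\<sigma> | length \<sigma> = n. \<Sum>t<n. g t t \<sigma>)"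
proof -
  let ?r = "\<lambda>\<sigma> t. if \<sigma> ! t then 1 else -1 :: real"
  have lt: "(\<Sum>\<sigma> | length \<sigma> = n. ?r \<sigma> s * ?r \<sigma> t * g s t \<sigma>) = 0" if "s < t" "t < n" for s t
  proof -
    have "(\<Sum>\<sigma> | length \<sigma> = n. ?r \<sigma> t * (?r \<sigma> s * g s t \<sigma>)) = 0"
    proof (rule sum_sign_eq_0[OF \<open>t < n\<close>])
      fix \<sigma> :: "bool list"
      have "g s t (\<sigma>[t := \<not> \<sigma> ! t]) = g s t \<sigma>" using that by (intro g) auto
      then show "?r (\<sigma>[t := \<not> \<sigma> ! t]) s * g s t (\<sigma>[t := \<not> \<sigma> ! t]) = ?r \<sigma> s * g s t \<sigma>"
        using that by simp
    qed
    then show ?thesis by (simp add: mult_ac)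
  qed
  have ne: "(\<Sum>\<sigma> | length \<sigma> = n. ?r \<sigma> s * ?r \<sigma> t * g s t \<sigma>) = 0"
    if "s \<noteq> t" "s < n" "t < n" for s t
  proof (cases "s < t")
    case False
    then have "(\<Sum>\<sigma> | length \<sigma> = n. ?r \<sigma> t * ?r \<sigma> s * g t s \<sigma>) = 0" using that by (intro lt) auto
    then show ?thesis by (subst sym) (simp add: mult_ac)
  qed (use that lt in blast)
  have "(\<Sum>\<sigma> | length \<sigma> = n. \<Sum>s<n. \<Sum>t<n. ?r \<sigma> s * ?r \<sigma> t * g s t \<sigma>)
      = (\<Sum>s<n. \<Sum>t<n. \<Sum>\<sigma> | length \<sigma> = n. ?r \<sigma> s * ?r \<sigma> t * g s t \<sigma>)"
    by (subst sum.swap, rule sum.cong[OF refl], rule sum.swap)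
  also have "\<dots> = (\<Sum>s<n. \<Sum>t<n. if t = s then (\<Sum>\<sigma> | length \<sigma> = n. g s s \<sigma>) else 0)"
  proof (intro sum.cong refl)
    fix s t assume "s \<in> {..<n}" "t \<in> {..<n}"
    then show "(\<Sum>\<sigma> | length \<sigma> = n. ?r \<sigma> s * ?r \<sigma> t * g s t \<sigma>)
        = (if t = s then (\<Sum>\<sigma> | length \<sigma> = n. g s s \<sigma>) else 0)"
      using ne[of s t] by (cases "t = s") (auto intro!: sum.cong)
  qed
  also have "\<dots> = (\<Sum>s<n. \<Sum>\<sigma> | length \<sigma> = n. g s s \<sigma>)" by simp
  also have "\<dots> = (\<Sum>\<sigma> | length \<sigma> = n. \<Sum>s<n. g s s \<sigma>)" by (rule sum.swap)
  finally show ?thesis .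
qed

definition tensor_square :: "nat \<Rightarrow> (nat \<Rightarrow> 'a::real_inner) \<Rightarrow> (nat \<Rightarrow> 'b::real_inner) \<Rightarrow> real" where
  "tensor_square n x w = (\<Sum>s<n. \<Sum>t<n. inner (x s) (x t) * inner (w s) (w t))"

text \<open>Both sides are the squared Hilbert--Schmidt norm of \<open>\<Sum>t<n. w t \<otimes> x t\<close>.\<close>
lemma tensor_square_orthonormal:
  assumes e: "orthonormal_upto d e" and x: "\<And>t. t < n \<Longrightarrow> x t = (\<Sum>i<d. inner (e i) (x t) *\<^sub>R e i)"
  shows "tensor_square n x w = (\<Sum>i<d. (norm (\<Sum>t<n. inner (e i) (x t) *\<^sub>R w t))\<^sup>2)"
proof -
  have xx: "inner (x s) (x t) = (\<Sum>i<d. inner (e i) (x s) * inner (e i) (x t))" if "s < n" for s t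
    by (subst x[OF that]) (simp add: inner_sum_left)
  have "tensor_square n x w
      = (\<Sum>s<n. \<Sum>t<n. \<Sum>i<d. inner (e i) (x s) * inner (e i) (x t) * inner (w s) (w t))"
    unfolding tensor_square_def by (intro sum.cong refl) (simp add: xx sum_distrib_right)
  also have "\<dots> = (\<Sum>s<n. \<Sum>i<d. \<Sum>t<n. inner (e i) (x s) * inner (e i) (x t) * inner (w s) (w t))"
    by (intro sum.cong refl sum.swap)
  also have "\<dots> = (\<Sum>i<d. \<Sum>s<n. \<Sum>t<n. inner (e i) (x s) * inner (e i) (x t) * inner (w s) (w t))"
    by (rule sum.swap)
  also have "\<dots> = (\<Sum>i<d. (norm (\<Sum>t<n. inner (e i) (x t) *\<^sub>R w t))\<^sup>2)"
    unfolding power2_norm_eq_inner inner_sum_left inner_sum_right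
    by (simp add: mult_ac inner_commute)
  finally show ?thesis .
qed

lemma sum_mult_le_sqrt:
  fixes a b :: "nat \<Rightarrow> real"
  shows "(\<Sum>i<d. a i * b i) \<le> sqrt (\<Sum>i<d. (a i)\<^sup>2) * sqrt (\<Sum>i<d. (b i)\<^sup>2)"
  using real_le_rsqrt[OF Cauchy_Schwarz_ineq_sum[of a b "{..<d}"]] by (simp only: real_sqrt_mult)

text \<open>Duality: the left side is the Hilbert--Schmidt pairing of f, restricted to the span of the
  \<open>x t\<close>, with \<open>\<Sum>t<n. w t \<otimes> x t\<close>.\<close>
lemma sum_inner_le_tensor_square:
  fixes f :: "'v::real_inner \<Rightarrow> 'w::real_inner"
  assumes f: "linear f" and K: "K \<ge> 0"
    and HS: "\<And>d e. d \<le> n \<Longrightarrow> orthonormal_upto d e \<Longrightarrow> (\<Sum>i<d. (norm (f (e i)))\<^sup>2) \<le> K\<^sup>2"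
  shows "(\<Sum>t<n. inner (f (x t)) (w t)) \<le> K * sqrt (tensor_square n x w)"
proof -
  obtain d e where d: "d \<le> n" and e: "orthonormal_upto d e"
    and x: "\<And>t. t < n \<Longrightarrow> x t = (\<Sum>i<d. inner (e i) (x t) *\<^sub>R e i)"
    using Gram_Schmidt[of n x] by blast
  let ?W = "\<lambda>i. \<Sum>t<n. inner (e i) (x t) *\<^sub>R w t"
  have fx: "f (x t) = (\<Sum>i<d. inner (e i) (x t) *\<^sub>R f (e i))" if "t < n" for t
    by (subst x[OF that]) (simp add: linear_sum[OF f] linear_scale[OF f])
  have "(\<Sum>t<n. inner (f (x t)) (w t)) = (\<Sum>t<n. \<Sum>i<d. inner (f (e i)) (inner (e i) (x t) *\<^sub>R w t))"
    by (intro sum.cong refl) (simp add: fx inner_sum_left)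
  also have "\<dots> = (\<Sum>i<d. inner (f (e i)) (?W i))"
    by (subst sum.swap) (simp add: inner_sum_right)
  also have "\<dots> \<le> (\<Sum>i<d. norm (f (e i)) * norm (?W i))"
    by (intro sum_mono norm_cauchy_schwarz)
  also have "\<dots> \<le> sqrt (\<Sum>i<d. (norm (f (e i)))\<^sup>2) * sqrt (\<Sum>i<d. (norm (?W i))\<^sup>2)"
    by (rule sum_mult_le_sqrt)
  also have "\<dots> \<le> K * sqrt (\<Sum>i<d. (norm (?W i))\<^sup>2)"
    using HS[OF d e] K by (intro mult_right_mono real_le_lsqrt real_sqrt_ge_zero sum_nonneg) auto
  also have "(\<Sum>i<d. (norm (?W i))\<^sup>2) = tensor_square n x w"
    by (rule tensor_square_orthonormal[OF e x, symmetric])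
  finally show ?thesis .
qed

text \<open>Ideal property of the Hilbert--Schmidt norm: in a fixed basis of the span of the
  \<open>x t\<close>, \<open>f\<close> acts on each column of the tensor separately.\<close>

lemma tensor_square_linear_le:
  fixes f :: "'v::real_inner \<Rightarrow> 'w::real_inner"
  assumes f: "linear f" and c: "c \<ge> 0" and bound: "\<And>v. norm (f v) \<le> c * norm v"
  shows "tensor_square n x (\<lambda>t. f (w t)) \<le> c\<^sup>2 * tensor_square n x w"
proof -
  obtain d e where e: "orthonormal_upto d e"
    and x: "\<And>t. t < n \<Longrightarrow> x t = (\<Sum>i<d. inner (e i) (x t) *\<^sub>R e i)"
    using Gram_Schmidt[of n x] by blast
  have "norm (\<Sum>t<n. inner (e i) (x t) *\<^sub>R f (w t)) \<le> c * norm (\<Sum>t<n. inner (e i) (x t) *\<^sub>R w t)" for i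
    using bound[of "\<Sum>t<n. inner (e i) (x t) *\<^sub>R w t"]
    by (simp add: linear_sum[OF f] linear_scale[OF f])
  then have "(\<Sum>i<d. (norm (\<Sum>t<n. inner (e i) (x t) *\<^sub>R f (w t)))\<^sup>2)
      \<le> (\<Sum>i<d. c\<^sup>2 * (norm (\<Sum>t<n. inner (e i) (x t) *\<^sub>R w t))\<^sup>2)"
    unfolding power_mult_distrib[symmetric] by (intro sum_mono power_mono) auto
  then show ?thesis
    by (simp add: tensor_square_orthonormal[OF e x] sum_distrib_left)
qed

lemma tensor_square_nonneg: "0 \<le> tensor_square n x w"
proof -
  obtain d e where e: "orthonormal_upto d e"
    and x: "\<And>t. t < n \<Longrightarrow> x t = (\<Sum>i<d. inner (e i) (x t) *\<^sub>R e i)"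
    using Gram_Schmidt[of n x] by blast
  show ?thesis using tensor_square_orthonormal[OF e x, where w = w] by (simp add: sum_nonneg)
qed

lemma mean_sqrt_sign_tensor_square_le:
  fixes x :: "nat \<Rightarrow> bool list \<Rightarrow> 'a::real_inner" and w :: "nat \<Rightarrow> bool list \<Rightarrow> 'b::real_inner"
  assumes "n > 0" and b: "b > 0"
    and x: "\<And>t \<sigma>. t < n \<Longrightarrow> length \<sigma> = n \<Longrightarrow> norm (x t (take t \<sigma>)) \<le> 1"
    and w: "\<And>t \<sigma>. t < n \<Longrightarrow> length \<sigma> = n \<Longrightarrow> norm (w t (take t \<sigma>)) \<le> b"
  shows "(\<Sum>\<sigma> | length \<sigma> = n. sqrt (tensor_square n (\<lambda>t. x t (take t \<sigma>))
      (\<lambda>t. (if \<sigma> ! t then 1 else -1) *\<^sub>R w t (take t \<sigma>)))) / 2 ^ n \<le> b * sqrt n"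
proof -
  define Q where "Q \<sigma> = tensor_square n (\<lambda>t. x t (take t \<sigma>))
      (\<lambda>t. (if \<sigma> ! t then 1 else -1) *\<^sub>R w t (take t \<sigma>))" for \<sigma> :: "bool list"
  have Q0: "0 \<le> Q \<sigma>" for \<sigma> by (simp add: Q_def tensor_square_nonneg)
  define g where "g s t \<sigma> = inner (x s (take s \<sigma>)) (x t (take t \<sigma>)) * inner (w s (take s \<sigma>)) (w t (take t \<sigma>))"
    for s t and \<sigma> :: "bool list"
  have "(\<Sum>\<sigma> | length \<sigma> = n. Q \<sigma>) = (\<Sum>\<sigma> | length \<sigma> = n. \<Sum>s<n. \<Sum>t<n.
      (if \<sigma> ! s then 1 else -1) * (if \<sigma> ! t then 1 else -1) * g s t \<sigma>)"
    unfolding Q_def tensor_square_def g_def by (intro sum.cong refl) (simp add: mult_ac)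
  also have "\<dots> = (\<Sum>\<sigma> | length \<sigma> = n. \<Sum>t<n. g t t \<sigma>)"
  proof (rule sum_sign_double_predictable)
    show "g s t \<sigma> = g t s \<sigma>" for s t \<sigma> by (simp add: g_def inner_commute)
    show "g s t \<sigma> = g s t \<sigma>'" if "s \<le> t" "take t \<sigma> = take t \<sigma>'" for s t \<sigma> \<sigma>'
    proof -
      have "take s \<sigma> = take s \<sigma>'" using that by (metis min.absorb1 take_take)
      then show ?thesis using that by (simp add: g_def)
    qed
  qed
  also have "\<dots> \<le> (\<Sum>\<sigma> | length (\<sigma>::bool list) = n. \<Sum>t<n. b\<^sup>2)"
  proof (intro sum_mono)
    fix \<sigma> :: "bool list" and t assume "\<sigma> \<in> {\<sigma>. length \<sigma> = n}" "t \<in> {..<n}"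
    then have "norm (x t (take t \<sigma>)) ^ 2 * norm (w t (take t \<sigma>)) ^ 2 \<le> 1 ^ 2 * b ^ 2"
      using x w by (intro mult_mono power_mono) auto
    then show "g t t \<sigma> \<le> b\<^sup>2" by (simp add: g_def power2_norm_eq_inner)
  qed
  also have "\<dots> = 2 ^ n * (n * b\<^sup>2)" by simp
  finally have Q: "(\<Sum>\<sigma> | length \<sigma> = n. Q \<sigma>) \<le> 2 ^ n * (n * b\<^sup>2)" .
  \<comment> \<open>\<open>h\<^sup>2\<close> bounds the mean of \<open>Q\<close>. Jensen's
    inequality for the square root is replaced by its tangent line at \<open>h\<^sup>2\<close>, and
    the two halves add up to \<open>h\<close>.\<close>
  define h where "h = b * sqrt n"
  have h: "h > 0" "h\<^sup>2 = n * b\<^sup>2" using assms by (auto simp: h_def power_mult_distrib)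
  have "sqrt (Q \<sigma>) \<le> Q \<sigma> / (2 * h) + h / 2" for \<sigma>
  proof -
    have "0 \<le> (sqrt (Q \<sigma>) - h)\<^sup>2" by simp
    then have "2 * h * sqrt (Q \<sigma>) \<le> Q \<sigma> + h\<^sup>2"
      using Q0[of \<sigma>] by (simp add: power2_diff mult_ac)
    then show ?thesis using h(1) by (simp add: field_simps power2_eq_square)
  qed
  then have "(\<Sum>\<sigma> | length \<sigma> = n. sqrt (Q \<sigma>)) \<le> (\<Sum>\<sigma> | length \<sigma> = n. Q \<sigma> / (2 * h) + h / 2)"
    by (intro sum_mono)
  also have "\<dots> = (\<Sum>\<sigma> | length \<sigma> = n. Q \<sigma>) / (2 * h) + 2 ^ n * (h / 2)"
    by (simp add: sum.distrib sum_divide_distrib)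
  also have "\<dots> \<le> 2 ^ n * h\<^sup>2 / (2 * h) + 2 ^ n * (h / 2)"
    using Q h by (intro add_right_mono divide_right_mono) auto
  also have "\<dots> = 2 ^ n * h" using h(1) by (simp add: field_simps power2_eq_square)
  finally show ?thesis by (simp add: Q_def h_def field_simps)
qed

text \<open>Expanding the square gives two pairings with \<open>f\<close>, against
  \<open>f (\<epsilon> t *\<^sub>R x t)\<close> and \<open>- (\<epsilon> t *\<^sub>R y t)\<close>,
  and a term free of \<open>f\<close>. The right side is uniform over all \<open>f\<close> with the
  given \<open>K\<close> and \<open>c\<close>.\<close>

lemma signed_square_loss_le:
  fixes f :: "'v::real_inner \<Rightarrow> 'w::real_inner" and \<epsilon> :: "nat \<Rightarrow> real"
  assumes f: "linear f" and c: "c \<ge> 0" and bound: "\<And>v. norm (f v) \<le> c * norm v" and K: "K \<ge> 0"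
    and HS: "\<And>d e. d \<le> n \<Longrightarrow> orthonormal_upto d e \<Longrightarrow> (\<Sum>i<d. (norm (f (e i)))\<^sup>2) \<le> K\<^sup>2"
  shows "(\<Sum>t<n. \<epsilon> t * (norm (f (x t) - y t))\<^sup>2)
    \<le> K * c * sqrt (tensor_square n x (\<lambda>t. \<epsilon> t *\<^sub>R x t))
      + 2 * K * sqrt (tensor_square n x (\<lambda>t. \<epsilon> t *\<^sub>R y t)) + (\<Sum>t<n. \<epsilon> t * (norm (y t))\<^sup>2)"
proof -
  have "(\<Sum>t<n. \<epsilon> t * (norm (f (x t) - y t))\<^sup>2)
      = (\<Sum>t<n. inner (f (x t)) (f (\<epsilon> t *\<^sub>R x t))) + 2 * (\<Sum>t<n. inner (f (x t)) (- (\<epsilon> t *\<^sub>R y t)))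
        + (\<Sum>t<n. \<epsilon> t * (norm (y t))\<^sup>2)"
    unfolding sum_distrib_left sum.distrib[symmetric]
  proof (rule sum.cong[OF refl])
    fix t
    have "(norm (f (x t) - y t))\<^sup>2
        = inner (f (x t)) (f (x t)) - 2 * inner (f (x t)) (y t) + (norm (y t))\<^sup>2"
      using norm_add_scaleR_square[of "f (x t)" "-1" "y t"]
      by (simp add: power2_norm_eq_inner[of "f (x t)"])
    then show "\<epsilon> t * (norm (f (x t) - y t))\<^sup>2 = inner (f (x t)) (f (\<epsilon> t *\<^sub>R x t))
        + 2 * inner (f (x t)) (- (\<epsilon> t *\<^sub>R y t)) + \<epsilon> t * (norm (y t))\<^sup>2"
      by (simp only: linear_scale[OF f] inner_scaleR_right inner_minus_right) (simp add: algebra_simps)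
  qed
  moreover have "(\<Sum>t<n. inner (f (x t)) (f (\<epsilon> t *\<^sub>R x t)))
      \<le> K * (c * sqrt (tensor_square n x (\<lambda>t. \<epsilon> t *\<^sub>R x t)))"
  proof -
    have "(\<Sum>t<n. inner (f (x t)) (f (\<epsilon> t *\<^sub>R x t)))
        \<le> K * sqrt (tensor_square n x (\<lambda>t. f (\<epsilon> t *\<^sub>R x t)))"
      by (rule sum_inner_le_tensor_square[OF f K HS])
    also have "sqrt (tensor_square n x (\<lambda>t. f (\<epsilon> t *\<^sub>R x t)))
        \<le> sqrt (c\<^sup>2 * tensor_square n x (\<lambda>t. \<epsilon> t *\<^sub>R x t))"
      by (intro real_sqrt_le_mono tensor_square_linear_le[OF f c bound])
    finally show ?thesis using K c by (simp add: real_sqrt_mult mult_left_mono)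
  qed
  moreover have "(\<Sum>t<n. inner (f (x t)) (- (\<epsilon> t *\<^sub>R y t)))
      \<le> K * sqrt (tensor_square n x (\<lambda>t. - (\<epsilon> t *\<^sub>R y t)))"
    by (rule sum_inner_le_tensor_square[OF f K HS])
  moreover have "tensor_square n x (\<lambda>t. - (\<epsilon> t *\<^sub>R y t)) = tensor_square n x (\<lambda>t. \<epsilon> t *\<^sub>R y t)"
    by (simp add: tensor_square_def)
  ultimately show ?thesis by (simp add: algebra_simps)
qed

lemma seq_rademacher_schatten_ball_le:
  fixes c :: real and p :: ereal
  assumes inf: "\<not> (\<exists>B::'v::{real_inner,complete_space} set. finite B \<and> span B = UNIV)"
    and c: "c > 0" and p: "p \<ge> 1"
  shows "seq_rademacher T (schatten_ball p c :: ('v \<Rightarrow> 'w::{real_inner,complete_space}) set)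
      (cball 0 1) (cball 0 c) \<le> 3 * c\<^sup>2 * real T powr schatten_exponent p"
proof -
  let ?F = "schatten_ball p c :: ('v \<Rightarrow> 'w) set"
  let ?r = "\<lambda>\<sigma> t. if \<sigma> ! t then 1 else -1 :: real"
  have F: "?F \<noteq> {}" using zero_in_schatten_ball[OF c p] by blast
  show ?thesis
    unfolding seq_rademacher_def
  proof (rule cSUP_least)
    show "{z::nat \<Rightarrow> bool list \<Rightarrow> 'v \<times> 'w.
        \<forall>t<T. \<forall>\<sigma>. length \<sigma> = t \<longrightarrow> z t \<sigma> \<in> cball 0 1 \<times> cball 0 c} \<noteq> {}"
      using c by (auto intro!: exI[of _ "\<lambda>_ _. (0, 0)"])
    fix z :: "nat \<Rightarrow> bool list \<Rightarrow> 'v \<times> 'w"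
    assume "z \<in> {z. \<forall>t<T. \<forall>\<sigma>. length \<sigma> = t \<longrightarrow> z t \<sigma> \<in> cball 0 1 \<times> cball 0 c}"
    then have z: "z t \<sigma> \<in> cball 0 1 \<times> cball 0 c" if "t < T" "length \<sigma> = t" for t \<sigma>
      using that by blast
    define x where "x t \<sigma> = fst (z t \<sigma>)" for t \<sigma>
    define y where "y t \<sigma> = snd (z t \<sigma>)" for t \<sigma>
    have nx: "norm (x t (take t \<sigma>)) \<le> 1" and ny: "norm (y t (take t \<sigma>)) \<le> c"
      if "t < T" "length \<sigma> = T" for t \<sigma>
      using z[of t "take t \<sigma>"] that by (auto simp: x_def y_def mem_Times_iff)
    show "(\<Sum>\<sigma> | length \<sigma> = T. SUP f\<in>?F. \<Sum>t<T. ?r \<sigma> t *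
        (norm (f (fst (z t (take t \<sigma>))) - snd (z t (take t \<sigma>))))\<^sup>2) / 2 ^ T
        \<le> 3 * c\<^sup>2 * real T powr schatten_exponent p"
    proof (cases "T = 0")
      \<comment> \<open>\<open>0 powr a\<close> is \<open>0\<close>, so the claim is that the
        complexity vanishes; only the empty sign list remains, with supremum
        \<open>0\<close>.\<close>
      case True
      then show ?thesis using F by simp
    next
      case False
      \<comment> \<open>Root of the Hilbert--Schmidt bound with the dimension raised to
        \<open>T\<close>, which the nonnegative exponent (\<open>exp\<close>) permits.\<close>
      define K where "K = c * real T powr (schatten_exponent p - 1/2)"
      have K0: "K \<ge> 0" using c by (simp add: K_def)
      have K2: "K\<^sup>2 = c\<^sup>2 * real T powr (2 * schatten_exponent p - 1)"
        using c by (simp add: K_def power_mult_distrib power2_eq_square flip: powr_add)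
      have exp: "0 \<le> 2 * schatten_exponent p - 1"
        using max.cobounded1[of "1/2" "1 - 1 / real_of_ereal p"]
        unfolding schatten_exponent_def by (smt (verit) field_sum_of_halves)
      define U where "U \<sigma> = sqrt (tensor_square T (\<lambda>t. x t (take t \<sigma>))
          (\<lambda>t. ?r \<sigma> t *\<^sub>R x t (take t \<sigma>)))" for \<sigma>
      define W where "W \<sigma> = sqrt (tensor_square T (\<lambda>t. x t (take t \<sigma>))
          (\<lambda>t. ?r \<sigma> t *\<^sub>R y t (take t \<sigma>)))" for \<sigma>
      define Z where "Z \<sigma> = (\<Sum>t<T. ?r \<sigma> t * (norm (y t (take t \<sigma>)))\<^sup>2)" for \<sigma>
      have le: "(SUP f\<in>?F. \<Sum>t<T. ?r \<sigma> t *
          (norm (f (fst (z t (take t \<sigma>))) - snd (z t (take t \<sigma>))))\<^sup>2)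
          \<le> K * c * U \<sigma> + 2 * K * W \<sigma> + Z \<sigma>" for \<sigma>
      proof (rule cSUP_least[OF F])
        fix f assume f: "f \<in> ?F"
        have HS: "(\<Sum>i<d. (norm (f (e i)))\<^sup>2) \<le> K\<^sup>2" if "d \<le> T" "orthonormal_upto d e" for d e
        proof -
          have "real d powr (2 * schatten_exponent p - 1) \<le> real T powr (2 * schatten_exponent p - 1)"
            using that exp by (intro powr_mono2) auto
          then show ?thesis
            using schatten_ball_sum_norm_orthonormal[OF inf f c p that(2)] unfolding K2
            by (smt (verit) mult_left_mono zero_le_power2)
        qed
        have lin: "linear f"
          using f by (simp add: schatten_ball_def compact_op_def bounded_linear.linear)
        show "(\<Sum>t<T. ?r \<sigma> t * (norm (f (fst (z t (take t \<sigma>))) - snd (z t (take t \<sigma>))))\<^sup>2)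
            \<le> K * c * U \<sigma> + 2 * K * W \<sigma> + Z \<sigma>"
          unfolding U_def W_def Z_def x_def y_def
          by (rule signed_square_loss_le[OF lin less_imp_le[OF c] schatten_ball_norm_le[OF inf f c p] K0 HS])
      qed
      have U: "(\<Sum>\<sigma> | length \<sigma> = T. U \<sigma>) / 2 ^ T \<le> 1 * sqrt T"
        unfolding U_def using False nx by (intro mean_sqrt_sign_tensor_square_le) auto
      have W: "(\<Sum>\<sigma> | length \<sigma> = T. W \<sigma>) / 2 ^ T \<le> c * sqrt T"
        unfolding W_def using False c nx ny by (intro mean_sqrt_sign_tensor_square_le) auto
      \<comment> \<open>The labels at time \<open>t\<close> depend only on earlier signs, so the
        current sign averages out.\<close>
      have Z: "(\<Sum>\<sigma> | length \<sigma> = T. Z \<sigma>) = 0"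
        unfolding Z_def
        by (subst sum.swap) (auto intro!: sum.neutral
            sum_sign_predictable_eq_0[of _ T "\<lambda>\<sigma>. (norm (y _ \<sigma>))\<^sup>2"])
      have "(\<Sum>\<sigma> | length \<sigma> = T. SUP f\<in>?F. \<Sum>t<T. ?r \<sigma> t *
          (norm (f (fst (z t (take t \<sigma>))) - snd (z t (take t \<sigma>))))\<^sup>2) / 2 ^ T
          \<le> (\<Sum>\<sigma> | length \<sigma> = T. K * c * U \<sigma> + 2 * K * W \<sigma> + Z \<sigma>) / 2 ^ T"
        by (intro divide_right_mono sum_mono le) auto
      also have "\<dots> = K * c * ((\<Sum>\<sigma> | length \<sigma> = T. U \<sigma>) / 2 ^ T)
          + 2 * K * ((\<Sum>\<sigma> | length \<sigma> = T. W \<sigma>) / 2 ^ T)"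
        by (simp add: sum.distrib Z add_divide_distrib flip: sum_distrib_left)
      also have "\<dots> \<le> K * c * (1 * sqrt T) + 2 * K * (c * sqrt T)"
        using K0 c by (intro add_mono mult_left_mono U W) auto
      also have "\<dots> = 3 * c\<^sup>2 * (real T powr (schatten_exponent p - 1/2) * real T powr (1/2))"
        by (simp add: K_def power2_eq_square powr_half_sqrt)
      also have "\<dots> = 3 * c\<^sup>2 * real T powr schatten_exponent p"
        by (simp flip: powr_add)
      finally show ?thesis .
    qed
  qed
qed

section \<open>Online regression with square loss\<close>

lemma sum_bool_lists_Suc:
  fixes g :: "bool list \<Rightarrow> real"
  shows "(\<Sum>\<sigma> | length \<sigma> = Suc k. g \<sigma>) = (\<Sum>\<sigma> | length \<sigma> = k. g (True # \<sigma>) + g (False # \<sigma>))"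
proof -
  let ?A = "{\<sigma>::bool list. length \<sigma> = k}"
  have "{\<sigma>::bool list. length \<sigma> = Suc k} = Cons True ` ?A \<union> Cons False ` ?A"
    by (auto simp: length_Suc_conv)
  moreover have "sum g (Cons True ` ?A \<union> Cons False ` ?A)
      = sum g (Cons True ` ?A) + sum g (Cons False ` ?A)"
    by (rule sum.union_disjoint) auto
  ultimately show ?thesis by (simp add: sum.reindex sum.distrib)
qed

lemma cSUP_mult_left_real:
  fixes g :: "'a \<Rightarrow> real"
  assumes "A \<noteq> {}" "bdd_above (g ` A)" "a > 0"
  shows "(SUP x\<in>A. a * g x) = a * (SUP x\<in>A. g x)"
proof (rule antisym)
  show "(SUP x\<in>A. a * g x) \<le> a * (SUP x\<in>A. g x)"
    using assms by (intro cSUP_least) (auto simp: cSUP_upper)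
  have "bdd_above ((\<lambda>x. a * g x) ` A)"
    using assms(2,3) by (fastforce simp: bdd_above_def intro: mult_left_mono)
  then have "g x \<le> (SUP x\<in>A. a * g x) / a" if "x \<in> A" for x
    using cSUP_upper[of x A "\<lambda>x. a * g x"] that assms(3) by (simp add: field_simps)
  then have "(SUP x\<in>A. g x) \<le> (SUP x\<in>A. a * g x) / a"
    by (intro cSUP_least[OF assms(1)])
  then show "a * (SUP x\<in>A. g x) \<le> (SUP x\<in>A. a * g x)"
    using assms(3) by (simp add: field_simps)
qed

lemma prob_space_rand_space: "prob_space rand_space"
  unfolding rand_space_def by (rule prob_space_uniform_measure) auto

text \<open>Convexity of \<open>Y\<close> keeps means of labels available as predictions; the
  uniform bound \<open>B\<close> keeps every real supremum finite and controls the second-order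
  error of the minimax step.\<close>

locale square_loss_game =
  fixes F :: "('v \<Rightarrow> 'w::real_inner) set" and X :: "'v set" and Y :: "'w set" and B :: real
  assumes F_ne: "F \<noteq> {}" and X_ne: "X \<noteq> {}" and Y_ne: "Y \<noteq> {}" and convex_Y: "convex Y"
    and loss_le: "\<And>f x y. f \<in> F \<Longrightarrow> x \<in> X \<Longrightarrow> y \<in> Y \<Longrightarrow> (norm (f x - y))\<^sup>2 \<le> B"
    and diam_le: "\<And>y y'. y \<in> Y \<Longrightarrow> y' \<in> Y \<Longrightarrow> (norm (y - y'))\<^sup>2 \<le> B"
begin

lemma B_nonneg: "0 \<le> B"
  using Y_ne diam_le by fastforce

definition loss :: "'v \<times> 'w \<Rightarrow> ('v \<Rightarrow> 'w) \<Rightarrow> real" where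
  "loss z f = (norm (f (fst z) - snd z))\<^sup>2"

definition trees :: "nat \<Rightarrow> (nat \<Rightarrow> bool list \<Rightarrow> 'v \<times> 'w) set" where
  "trees k = {z. \<forall>t<k. \<forall>\<sigma>. length \<sigma> = t \<longrightarrow> z t \<sigma> \<in> X \<times> Y}"

definition path_sum :: "nat \<Rightarrow> (nat \<Rightarrow> bool list \<Rightarrow> 'v \<times> 'w) \<Rightarrow> bool list \<Rightarrow> ('v \<Rightarrow> 'w) \<Rightarrow> real" where
  "path_sum k z \<sigma> f = (\<Sum>t<k. (if \<sigma> ! t then 1 else -1) * loss (z t (take t \<sigma>)) f)"

definition tree_value :: "nat \<Rightarrow> (nat \<Rightarrow> bool list \<Rightarrow> 'v \<times> 'w) \<Rightarrow> (('v \<Rightarrow> 'w) \<Rightarrow> real) \<Rightarrow> real" where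
  "tree_value k z \<phi> = (\<Sum>\<sigma> | length \<sigma> = k. SUP f\<in>F. \<phi> f + 2 * path_sum k z \<sigma> f) / 2 ^ k"

text \<open>Twice the sequential Rademacher complexity over \<open>k\<close> remaining rounds, offset by \<open>\<phi>\<close>.
  With \<open>\<phi>\<close> the negated past loss it is an upper bound for the value of the remaining game.\<close>
definition relaxation :: "nat \<Rightarrow> (('v \<Rightarrow> 'w) \<Rightarrow> real) \<Rightarrow> real" where
  "relaxation k \<phi> = (SUP z\<in>trees k. tree_value k z \<phi>)"

text \<open>Two-sided, so that it survives subtraction of losses from the offset.\<close>

definition bdd_on_F :: "(('v \<Rightarrow> 'w) \<Rightarrow> real) \<Rightarrow> bool" where
  "bdd_on_F \<phi> \<longleftrightarrow> (\<exists>C. \<forall>f\<in>F. \<bar>\<phi> f\<bar> \<le> C)"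

section \<open>Finiteness of the suprema, convexity and recursion of the relaxation\<close>

lemma loss_bounds: "z \<in> X \<times> Y \<Longrightarrow> f \<in> F \<Longrightarrow> \<bar>loss z f\<bar> \<le> B"
  using loss_le by (auto simp: loss_def)

lemma bdd_on_F_const [simp]: "bdd_on_F (\<lambda>_. a)"
  by (auto simp: bdd_on_F_def)

lemma bdd_on_F_loss: "z \<in> X \<times> Y \<Longrightarrow> bdd_on_F (loss z)"
  using loss_bounds by (auto simp: bdd_on_F_def)

lemma bdd_on_F_add: "bdd_on_F \<phi> \<Longrightarrow> bdd_on_F \<psi> \<Longrightarrow> bdd_on_F (\<lambda>f. \<phi> f + \<psi> f)"
  unfolding bdd_on_F_def by (meson abs_triangle_ineq add_mono order_trans)

lemma bdd_on_F_scale: "bdd_on_F \<phi> \<Longrightarrow> bdd_on_F (\<lambda>f. a * \<phi> f)"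
  unfolding bdd_on_F_def abs_mult by (meson abs_ge_zero mult_left_mono)

lemma bdd_on_F_diff: "bdd_on_F \<phi> \<Longrightarrow> bdd_on_F \<psi> \<Longrightarrow> bdd_on_F (\<lambda>f. \<phi> f - \<psi> f)"
  using bdd_on_F_add[of \<phi> "\<lambda>f. - 1 * \<psi> f"] bdd_on_F_scale[of \<psi> "- 1"] by simp

lemma bdd_on_F_sum: "(\<And>i. i \<in> I \<Longrightarrow> bdd_on_F (\<phi> i)) \<Longrightarrow> bdd_on_F (\<lambda>f. \<Sum>i\<in>I. \<phi> i f)"
  by (induction I rule: infinite_finite_induct) (auto intro: bdd_on_F_add)

lemma trees_ne: "trees k \<noteq> {}"
  using X_ne Y_ne by (force simp: trees_def)

lemma path_sum_bounds:
  assumes "z \<in> trees k" "length \<sigma> = k" "f \<in> F"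
  shows "\<bar>path_sum k z \<sigma> f\<bar> \<le> real k * B"
proof -
  have "\<bar>path_sum k z \<sigma> f\<bar> \<le> (\<Sum>t<k. \<bar>(if \<sigma> ! t then 1 else -1) * loss (z t (take t \<sigma>)) f\<bar>)"
    unfolding path_sum_def by (rule sum_abs)
  also have "\<dots> \<le> (\<Sum>t<k. B)"
  proof (rule sum_mono)
    fix t assume "t \<in> {..<k}"
    then have "z t (take t \<sigma>) \<in> X \<times> Y" using assms by (auto simp: trees_def)
    then show "\<bar>(if \<sigma> ! t then 1 else -1) * loss (z t (take t \<sigma>)) f\<bar> \<le> B"
      using loss_bounds assms(3) by auto
  qed
  finally show ?thesis by simp
qed

lemma bdd_above_path_sum:
  assumes "z \<in> trees k" "length \<sigma> = k" "bdd_on_F \<phi>"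
  shows "bdd_above ((\<lambda>f. \<phi> f + 2 * path_sum k z \<sigma> f) ` F)"
proof -
  obtain C where "\<And>f. f \<in> F \<Longrightarrow> \<bar>\<phi> f\<bar> \<le> C" using assms by (auto simp: bdd_on_F_def)
  then have "\<phi> f + 2 * path_sum k z \<sigma> f \<le> C + 2 * (real k * B)" if "f \<in> F" for f
    using path_sum_bounds[OF assms(1,2) that] that by fastforce
  then show ?thesis by (rule bdd_aboveI2)
qed

lemma bdd_above_tree_value:
  assumes "bdd_on_F \<phi>"
  shows "bdd_above ((\<lambda>z. tree_value k z \<phi>) ` trees k)"
proof -
  obtain C where C: "\<And>f. f \<in> F \<Longrightarrow> \<bar>\<phi> f\<bar> \<le> C" using assms by (auto simp: bdd_on_F_def)
  show ?thesis
  proof (rule bdd_aboveI2)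
    fix z assume z: "z \<in> trees k"
    have "(\<Sum>\<sigma> | length \<sigma> = k. SUP f\<in>F. \<phi> f + 2 * path_sum k z \<sigma> f)
        \<le> (\<Sum>\<sigma> | length (\<sigma> :: bool list) = k. C + 2 * (real k * B))"
    proof (intro sum_mono cSUP_least F_ne)
      fix \<sigma> :: "bool list" and f assume "\<sigma> \<in> {\<sigma>. length \<sigma> = k}" and "f \<in> F"
      then show "\<phi> f + 2 * path_sum k z \<sigma> f \<le> C + 2 * (real k * B)"
        using path_sum_bounds[OF z, of \<sigma> f] C[of f] by auto
    qed
    then show "tree_value k z \<phi> \<le> C + 2 * (real k * B)"
      by (simp add: tree_value_def field_simps)
  qed
qed

lemma tree_value_le_relaxation: "bdd_on_F \<phi> \<Longrightarrow> z \<in> trees k \<Longrightarrow> tree_value k z \<phi> \<le> relaxation k \<phi>"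
  unfolding relaxation_def by (intro cSUP_upper bdd_above_tree_value)

text \<open>The relaxation is built from suprema and averages of functions affine in the offset.
  Since the weights sum to 1, the path sum can be distributed over them.\<close>

lemma relaxation_Jensen:
  assumes "finite I" and u: "\<And>i. i \<in> I \<Longrightarrow> 0 \<le> u i" and u1: "sum u I = 1"
    and \<phi>: "\<And>i. i \<in> I \<Longrightarrow> bdd_on_F (\<phi> i)"
  shows "relaxation k (\<lambda>f. \<Sum>i\<in>I. u i * \<phi> i f) \<le> (\<Sum>i\<in>I. u i * relaxation k (\<phi> i))"
  unfolding relaxation_def[of k "\<lambda>f. \<Sum>i\<in>I. u i * \<phi> i f"]
proof (rule cSUP_least[OF trees_ne])
  fix z assume z: "z \<in> trees k"
  let ?S = "\<lambda>\<sigma> i. SUP f\<in>F. \<phi> i f + 2 * path_sum k z \<sigma> f"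
  have "(SUP f\<in>F. (\<Sum>i\<in>I. u i * \<phi> i f) + 2 * path_sum k z \<sigma> f) \<le> (\<Sum>i\<in>I. u i * ?S \<sigma> i)"
    if "length \<sigma> = k" for \<sigma>
  proof (rule cSUP_least[OF F_ne])
    fix f assume f: "f \<in> F"
    have "(\<Sum>i\<in>I. u i * \<phi> i f) + 2 * path_sum k z \<sigma> f
        = (\<Sum>i\<in>I. u i * (\<phi> i f + 2 * path_sum k z \<sigma> f))"
      by (simp add: distrib_left sum.distrib u1 flip: sum_distrib_right)
    also have "\<dots> \<le> (\<Sum>i\<in>I. u i * ?S \<sigma> i)"
      using f that z \<phi> u by (intro sum_mono mult_left_mono cSUP_upper bdd_above_path_sum) auto
    finally show "(\<Sum>i\<in>I. u i * \<phi> i f) + 2 * path_sum k z \<sigma> f \<le> (\<Sum>i\<in>I. u i * ?S \<sigma> i)" .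
  qed
  then have "tree_value k z (\<lambda>f. \<Sum>i\<in>I. u i * \<phi> i f)
      \<le> (\<Sum>\<sigma> | length \<sigma> = k. \<Sum>i\<in>I. u i * ?S \<sigma> i) / 2 ^ k"
    unfolding tree_value_def by (intro divide_right_mono sum_mono) auto
  also have "\<dots> = (\<Sum>i\<in>I. u i * tree_value k z (\<phi> i))"
    by (subst sum.swap) (simp add: tree_value_def sum_divide_distrib sum_distrib_left)
  also have "\<dots> \<le> (\<Sum>i\<in>I. u i * relaxation k (\<phi> i))"
    using u \<phi> z by (intro sum_mono mult_left_mono tree_value_le_relaxation) auto
  finally show "tree_value k z (\<lambda>f. \<Sum>i\<in>I. u i * \<phi> i f) \<le> (\<Sum>i\<in>I. u i * relaxation k (\<phi> i))" .
qed

lemma relaxation_midpoint: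
  assumes "bdd_on_F \<phi>" "bdd_on_F \<psi>"
  shows "relaxation k (\<lambda>f. (\<phi> f + \<psi> f) / 2) \<le> (relaxation k \<phi> + relaxation k \<psi>) / 2"
  using relaxation_Jensen[of "UNIV :: bool set" "\<lambda>_. 1/2" "\<lambda>b. if b then \<phi> else \<psi>" k] assms
  by (simp add: UNIV_bool add_divide_distrib add.commute)

lemma relaxation_add_le:
  assumes le: "\<And>f. f \<in> F \<Longrightarrow> \<phi> f + a \<le> \<psi> f" and \<psi>: "bdd_on_F \<psi>"
  shows "relaxation k \<phi> + a \<le> relaxation k \<psi>"
proof -
  have "relaxation k \<phi> \<le> relaxation k \<psi> - a"
    unfolding relaxation_def[of k \<phi>]
  proof (rule cSUP_least[OF trees_ne])
    fix z assume z: "z \<in> trees k"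
    have "(SUP f\<in>F. \<phi> f + 2 * path_sum k z \<sigma> f) \<le> (SUP f\<in>F. \<psi> f + 2 * path_sum k z \<sigma> f) - a"
      if "length \<sigma> = k" for \<sigma>
    proof (rule cSUP_least[OF F_ne])
      fix f assume f: "f \<in> F"
      have "\<psi> f + 2 * path_sum k z \<sigma> f \<le> (SUP f\<in>F. \<psi> f + 2 * path_sum k z \<sigma> f)"
        using f z that \<psi> by (intro cSUP_upper bdd_above_path_sum)
      then show "\<phi> f + 2 * path_sum k z \<sigma> f \<le> (SUP f\<in>F. \<psi> f + 2 * path_sum k z \<sigma> f) - a"
        using le[OF f] by linarith
    qed
    then have "tree_value k z \<phi>
        \<le> (\<Sum>\<sigma> | length \<sigma> = k. (SUP f\<in>F. \<psi> f + 2 * path_sum k z \<sigma> f) - a) / 2 ^ k"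
      unfolding tree_value_def by (intro divide_right_mono sum_mono) auto
    also have "\<dots> = tree_value k z \<psi> - a"
      by (simp add: tree_value_def sum_subtractf diff_divide_distrib)
    finally show "tree_value k z \<phi> \<le> relaxation k \<psi> - a"
      using tree_value_le_relaxation[OF \<psi> z] by linarith
  qed
  then show ?thesis by simp
qed

text \<open>The two terms are the branches after the root of a tree of depth \<open>Suc k\<close>:
  fixing the root to be \<open>z0\<close> can only lower the supremum.\<close>

lemma relaxation_split:
  assumes z0: "z0 \<in> X \<times> Y" and \<phi>: "bdd_on_F \<phi>"
  shows "relaxation k (\<lambda>f. \<phi> f + 2 * loss z0 f) + relaxation k (\<lambda>f. \<phi> f - 2 * loss z0 f)
    \<le> 2 * relaxation (Suc k) \<phi>"
proof -
  let ?p = "\<lambda>f. \<phi> f + 2 * loss z0 f" and ?m = "\<lambda>f. \<phi> f - 2 * loss z0 f"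
  have *: "tree_value k z1 ?p + tree_value k z2 ?m \<le> 2 * relaxation (Suc k) \<phi>"
    if z: "z1 \<in> trees k" "z2 \<in> trees k" for z1 z2
  proof -
    \<comment> \<open>Root \<open>z0\<close>; the first sign selects the subtree, which sees the
      remaining signs.\<close>
    define z where
      "z t \<sigma> = (case t of 0 \<Rightarrow> z0 | Suc t' \<Rightarrow> (if hd \<sigma> then z1 else z2) t' (tl \<sigma>))" for t \<sigma>
    have "z \<in> trees (Suc k)"
      using z z0 by (auto simp: trees_def z_def split: nat.split)
    moreover have "path_sum (Suc k) z (b # \<sigma>) f
        = (if b then 1 else -1) * loss z0 f + path_sum k (if b then z1 else z2) \<sigma> f" for b \<sigma> f
      unfolding path_sum_def sum.lessThan_Suc_shift by (simp add: z_def)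
    then have "2 * tree_value (Suc k) z \<phi> = tree_value k z1 ?p + tree_value k z2 ?m"
      by (simp add: tree_value_def sum_bool_lists_Suc sum.distrib add_divide_distrib algebra_simps)
    ultimately show ?thesis using tree_value_le_relaxation[OF \<phi>] by (smt (verit))
  qed
  \<comment> \<open>The subtrees vary independently, so the joint bound passes to the two suprema
    one at a time.\<close>
  have "relaxation k ?p \<le> 2 * relaxation (Suc k) \<phi> - tree_value k z2 ?m" if "z2 \<in> trees k" for z2
    unfolding relaxation_def[of k ?p] using * that
    by (intro cSUP_least[OF trees_ne]) (simp add: le_diff_eq)
  then have "relaxation k ?m \<le> 2 * relaxation (Suc k) \<phi> - relaxation k ?p"
    unfolding relaxation_def[of k ?m]
    by (intro cSUP_least[OF trees_ne]) (simp add: le_diff_eq add.commute)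
  then show ?thesis by simp
qed

text \<open>Symmetrisation of one round, with convexity in the offset doing the work of the usual ghost
  sample.\<close>
lemma relaxation_variance_le:
  assumes S: "finite S" "S \<subseteq> Y" and u: "\<And>y. y \<in> S \<Longrightarrow> 0 \<le> u y" "sum u S = 1"
    and x: "x \<in> X" and \<phi>: "bdd_on_F \<phi>"
  shows "(\<Sum>y\<in>S. u y * ((norm y)\<^sup>2 + relaxation k (\<lambda>f. \<phi> f - loss (x, y) f)))
      - (norm (\<Sum>y\<in>S. u y *\<^sub>R y))\<^sup>2 \<le> relaxation (Suc k) \<phi>"
proof -
  define m where "m = (\<Sum>y\<in>S. u y *\<^sub>R y)"
  define var where "var = (\<Sum>y\<in>S. u y * (norm y)\<^sup>2) - (norm m)\<^sup>2"
  define P where "P y = relaxation k (\<lambda>f. \<phi> f + 2 * loss (x, y) f)" for y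
  define N where "N y = relaxation k (\<lambda>f. \<phi> f - 2 * loss (x, y) f)" for y
  have bdd: "bdd_on_F (loss (x, y))" if "y \<in> S" for y
    using that S x by (intro bdd_on_F_loss) auto
  \<comment> \<open>Bias-variance decomposition: the mean \<open>m\<close> minimises the expected
    square loss, so the variance is at most the expected loss of any comparator on a fresh
    label.\<close>
  have var_le: "var \<le> (\<Sum>y\<in>S. u y * loss (x, y) f)" for f
  proof -
    have "(\<Sum>y\<in>S. u y * loss (x, y) f)
        = (\<Sum>y\<in>S. u y * (norm (f x))\<^sup>2 - 2 * inner (f x) (u y *\<^sub>R y) + u y * (norm y)\<^sup>2)"
      by (intro sum.cong refl)
         (simp add: loss_def power2_norm_eq_inner inner_diff inner_commute algebra_simps)
    also have "\<dots> = (norm (f x))\<^sup>2 - 2 * inner (f x) m + (\<Sum>y\<in>S. u y * (norm y)\<^sup>2)"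
      by (simp add: sum.distrib sum_subtractf u(2) m_def inner_sum_right
          flip: sum_distrib_left sum_distrib_right)
    also have "\<dots> = (norm (f x - m))\<^sup>2 + var"
      by (simp add: var_def power2_norm_eq_inner inner_diff inner_commute algebra_simps)
    finally show ?thesis by simp
  qed
  have *: "relaxation k (\<lambda>f. \<phi> f - loss (x, y) f) + var \<le> (\<Sum>y'\<in>S. u y' * ((P y' + N y) / 2))"
    if y: "y \<in> S" for y
  proof -
    have "relaxation k (\<lambda>f. \<phi> f - loss (x, y) f) + var
        \<le> relaxation k (\<lambda>f. \<Sum>y'\<in>S. u y' * (\<phi> f - loss (x, y) f + loss (x, y') f))"
    proof (rule relaxation_add_le)
      show "\<phi> f - loss (x, y) f + var \<le> (\<Sum>y'\<in>S. u y' * (\<phi> f - loss (x, y) f + loss (x, y') f))"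
        for f
        using var_le[of f] by (simp add: distrib_left[of "u _"] sum.distrib u(2) flip: sum_distrib_right)
    qed (use bdd y \<phi> in \<open>auto intro!: bdd_on_F_sum bdd_on_F_scale bdd_on_F_add bdd_on_F_diff\<close>)
    also have "\<dots> \<le> (\<Sum>y'\<in>S. u y' * relaxation k (\<lambda>f. \<phi> f - loss (x, y) f + loss (x, y') f))"
      using S u bdd y \<phi> by (intro relaxation_Jensen) (auto intro!: bdd_on_F_add bdd_on_F_diff)
    also have "\<dots> \<le> (\<Sum>y'\<in>S. u y' * ((P y' + N y) / 2))"
    proof (intro sum_mono mult_left_mono u)
      fix y' assume y': "y' \<in> S"
      \<comment> \<open>The difference of two losses is a midpoint of offsets carrying a doubled
        loss each; hence the factor 2 in front of the complexity.\<close>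
      have "(\<lambda>f. \<phi> f - loss (x, y) f + loss (x, y') f)
          = (\<lambda>f. ((\<phi> f + 2 * loss (x, y') f) + (\<phi> f - 2 * loss (x, y) f)) / 2)"
        by (simp add: fun_eq_iff field_simps)
      then show "relaxation k (\<lambda>f. \<phi> f - loss (x, y) f + loss (x, y') f) \<le> (P y' + N y) / 2"
        unfolding P_def N_def using y y' \<phi> bdd
        by (simp only:) (intro relaxation_midpoint bdd_on_F_add bdd_on_F_diff bdd_on_F_scale)
    qed
    finally show ?thesis .
  qed
  have "(\<Sum>y\<in>S. u y * ((norm y)\<^sup>2 + relaxation k (\<lambda>f. \<phi> f - loss (x, y) f))) - (norm m)\<^sup>2
      = (\<Sum>y\<in>S. u y * (relaxation k (\<lambda>f. \<phi> f - loss (x, y) f) + var))"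
    by (simp add: distrib_left sum.distrib var_def u(2) flip: sum_distrib_right)
  also have "\<dots> \<le> (\<Sum>y\<in>S. u y * (\<Sum>y'\<in>S. u y' * ((P y' + N y) / 2)))"
    using u * by (intro sum_mono mult_left_mono)
  also have "\<dots> = (\<Sum>y\<in>S. u y * ((\<Sum>y'\<in>S. u y' * P y') / 2 + N y / 2))"
    using u(2) by (simp add: add_divide_distrib distrib_left sum.distrib sum_divide_distrib
        flip: sum_distrib_right times_divide_eq_right)
  \<comment> \<open>\<open>y\<close> and \<open>y'\<close> have the same law and occur in separate
    summands, so they may be identified; both branches then share the root
    \<open>(x, y)\<close>.\<close>
  also have "\<dots> = (\<Sum>y\<in>S. u y * ((P y + N y) / 2))"
    using u(2) by (simp add: add_divide_distrib distrib_left sum.distrib sum_divide_distrib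
        flip: sum_distrib_right)
  also have "\<dots> \<le> (\<Sum>y\<in>S. u y * relaxation (Suc k) \<phi>)"
  proof (intro sum_mono mult_left_mono u)
    fix y assume "y \<in> S"
    then show "(P y + N y) / 2 \<le> relaxation (Suc k) \<phi>"
      using relaxation_split[of "(x, y)" \<phi> k] S x \<phi> by (auto simp: P_def N_def)
  qed
  also have "\<dots> = relaxation (Suc k) \<phi>" by (simp add: u(2) flip: sum_distrib_right)
  finally show ?thesis by (simp add: m_def)
qed

text \<open>The minimax step without a minimax theorem. Over the convex hull of the points
  \<open>(y, norm y ^ 2 + \<Phi> y)\<close> the function \<open>(m, r) \<mapsto> r - norm m ^ 2\<close> is concave, and the
  first-order condition at a near-maximiser in the direction of \<open>y\<close> says that predicting \<open>m\<close> is
  good against \<open>y\<close>.\<close>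
lemma relaxation_admissible:
  assumes x: "x \<in> X" and \<phi>: "bdd_on_F \<phi>" and \<epsilon>: "\<epsilon> > 0"
  shows "\<exists>m\<in>Y. \<forall>y\<in>Y. (norm (m - y))\<^sup>2 + relaxation k (\<lambda>f. \<phi> f - loss (x, y) f)
    \<le> relaxation (Suc k) \<phi> + \<epsilon>"
proof -
  define \<Phi> where "\<Phi> y = (norm y)\<^sup>2 + relaxation k (\<lambda>f. \<phi> f - loss (x, y) f)" for y
  define H where "H = convex hull ((\<lambda>y. (y, \<Phi> y)) ` Y)"
  define g where "g p = snd p - (norm (fst p))\<^sup>2" for p :: "'w \<times> real"
  \<comment> \<open>A point of the hull is a finite label distribution: its first coordinate is the
    mean label, and \<open>g\<close> is the expression bounded by
    \<open>relaxation_variance_le\<close>.\<close>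
  have H: "fst p \<in> Y \<and> g p \<le> relaxation (Suc k) \<phi>" if "p \<in> H" for p
  proof -
    obtain S u where S: "finite S" "S \<subseteq> (\<lambda>y. (y, \<Phi> y)) ` Y"
      and u: "\<And>v. v \<in> S \<Longrightarrow> 0 \<le> u v" "sum u S = 1" and p: "(\<Sum>v\<in>S. u v *\<^sub>R v) = p"
      using \<open>p \<in> H\<close> unfolding H_def convex_hull_explicit by blast
    define S' where "S' = fst ` S"
    define u' where "u' y = u (y, \<Phi> y)" for y
    have S_eq: "S = (\<lambda>y. (y, \<Phi> y)) ` S'" using S(2) by (force simp: S'_def)
    have inj: "inj_on (\<lambda>y. (y, \<Phi> y)) S'" by (auto simp: inj_on_def)
    have S': "finite S'" "S' \<subseteq> Y" using S by (auto simp: S'_def)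
    have u': "\<And>y. y \<in> S' \<Longrightarrow> 0 \<le> u' y" "sum u' S' = 1"
      using u by (auto simp: u'_def S_eq sum.reindex[OF inj] comp_def)
    have fp: "fst p = (\<Sum>y\<in>S'. u' y *\<^sub>R y)" and sp: "snd p = (\<Sum>y\<in>S'. u' y * \<Phi> y)"
      unfolding p[symmetric] S_eq sum.reindex[OF inj]
      by (simp_all add: fst_sum snd_sum u'_def)
    have "fst p \<in> Y" unfolding fp using S' u' convex_Y by (intro convex_sum) auto
    moreover have "g p \<le> relaxation (Suc k) \<phi>"
      unfolding g_def fp sp \<Phi>_def using S' u' x \<phi> by (intro relaxation_variance_le) auto
    ultimately show ?thesis by blast
  qed
  have H_ne: "H \<noteq> {}" using Y_ne by (simp add: H_def)
  have bdd: "bdd_above (g ` H)" using H by (meson bdd_aboveI2)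
  \<comment> \<open>Step length towards a label: at most 1 to stay in the hull, and small enough
    that the second-order error \<open>lam * B\<close> is at most
    \<open>\<epsilon> / 2\<close>.\<close>
  define lam where "lam = min 1 (\<epsilon> / (2 * (B + 1)))"
  have l: "lam > 0" "lam \<le> 1" using \<epsilon> B_nonneg by (auto simp: lam_def)
  have "lam * B \<le> \<epsilon> / (2 * (B + 1)) * B" using B_nonneg by (intro mult_right_mono) (auto simp: lam_def)
  also have "\<dots> \<le> \<epsilon> / 2" using B_nonneg \<epsilon> by (simp add: field_simps)
  finally have lB: "lam * B \<le> \<epsilon> / 2" .
  \<comment> \<open>The slack is scaled by the step length, so division by \<open>lam\<close> leaves
    the other \<open>\<epsilon> / 2\<close>.\<close>
  have "(SUP p\<in>H. g p) - lam * \<epsilon> / 2 < (SUP p\<in>H. g p)" using l \<epsilon> by simp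
  then obtain p where p: "p \<in> H" and near: "(SUP p\<in>H. g p) - lam * \<epsilon> / 2 < g p"
    using less_cSUP_iff[OF H_ne bdd] by blast
  define m where "m = fst p"
  have m: "m \<in> Y" using H[OF p] by (simp add: m_def)
  have "(norm (m - y))\<^sup>2 + relaxation k (\<lambda>f. \<phi> f - loss (x, y) f) \<le> relaxation (Suc k) \<phi> + \<epsilon>"
    if y: "y \<in> Y" for y
  proof -
    \<comment> \<open>Directional derivative of \<open>g\<close> at \<open>p\<close> towards
      \<open>(y, \<Phi> y)\<close>.\<close>
    define D where "D = (norm (m - y))\<^sup>2 + \<Phi> y - (norm y)\<^sup>2 - g p"
    have "(y, \<Phi> y) \<in> H" unfolding H_def using y by (intro hull_inc) auto
    moreover define q where "q = (1 - lam) *\<^sub>R p + lam *\<^sub>R (y, \<Phi> y)"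
    ultimately have "q \<in> H"
      using p l convex_convex_hull unfolding H_def q_def by (intro convexD) auto
    then have "g q \<le> (SUP p\<in>H. g p)" using bdd by (rule cSUP_upper)
    then have "g q \<le> g p + lam * \<epsilon> / 2" using near by linarith
    moreover have "g q = g p + lam * D - lam\<^sup>2 * (norm (m - y))\<^sup>2"
    proof -
      have "fst q = m + lam *\<^sub>R (y - m)" by (simp add: q_def m_def algebra_simps)
      then have "(norm (fst q))\<^sup>2
          = (norm m)\<^sup>2 + lam * (2 * inner m (y - m)) + lam\<^sup>2 * (norm (m - y))\<^sup>2"
        by (simp add: norm_add_scaleR_square norm_minus_commute)
      moreover have "snd q = (1 - lam) * snd p + lam * \<Phi> y" by (simp add: q_def)
      moreover have "2 * inner m (y - m) = (norm y)\<^sup>2 - (norm m)\<^sup>2 - (norm (m - y))\<^sup>2"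
        using norm_add_scaleR_square[of m "-1" y]
        by (simp add: inner_diff_right power2_norm_eq_inner[of m])
      ultimately show ?thesis unfolding g_def D_def m_def[symmetric]
        by (simp only:) (simp add: algebra_simps)
    qed
    moreover have "lam\<^sup>2 * (norm (m - y))\<^sup>2 \<le> lam * (\<epsilon> / 2)"
    proof -
      have "lam * (lam * (norm (m - y))\<^sup>2) \<le> lam * (lam * B)"
        using l diam_le[OF m y] by simp
      also have "\<dots> \<le> lam * (\<epsilon> / 2)" using l lB by simp
      finally show ?thesis by (simp add: power2_eq_square mult.assoc)
    qed
    ultimately have "lam * D \<le> lam * \<epsilon>" by simp
    then have "D \<le> \<epsilon>" using l by simp
    then show ?thesis using H[OF p] by (simp add: D_def \<Phi>_def)
  qed
  then show ?thesis using m by blast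
qed

section \<open>From one round to the regret of the learner\<close>

lemma relaxation_0_ge: "bdd_on_F \<phi> \<Longrightarrow> f \<in> F \<Longrightarrow> \<phi> f \<le> relaxation 0 \<phi>"
proof -
  assume \<phi>: "bdd_on_F \<phi>" and f: "f \<in> F"
  have z: "z \<in> trees 0" for z by (simp add: trees_def)
  have "\<phi> f \<le> tree_value 0 z \<phi>" for z
    unfolding tree_value_def using bdd_above_path_sum[OF z[of z], of "[]" \<phi>] \<phi> f
    by (simp add: path_sum_def cSUP_upper)
  then show ?thesis using tree_value_le_relaxation[OF \<phi> z] order_trans by blast
qed

lemma regret_le_relaxation:
  assumes \<epsilon>: "\<epsilon> > 0"
  shows "\<exists>A\<in>online_algorithms Y. regret A T F X Y \<le> relaxation T (\<lambda>_. 0) + real T * \<epsilon>"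
proof -
  interpret prob_space rand_space by (rule prob_space_rand_space)
  \<comment> \<open>Outside \<open>X\<close>, or for an unbounded offset, any point of
    \<open>Y\<close> is accepted: a learner must predict in \<open>Y\<close> on every
    history.\<close>
  define good where "good k \<phi> x m \<longleftrightarrow> m \<in> Y \<and> (x \<in> X \<and> bdd_on_F \<phi> \<longrightarrow> (\<forall>y\<in>Y. (norm (m - y))\<^sup>2
      + relaxation k (\<lambda>f. \<phi> f - loss (x, y) f) \<le> relaxation (Suc k) \<phi> + \<epsilon>))" for k \<phi> x m
  define P where "P k \<phi> x = (SOME m. good k \<phi> x m)" for k \<phi> x
  have "\<exists>m. good k \<phi> x m" for k \<phi> x
  proof (cases "x \<in> X \<and> bdd_on_F \<phi>")
    case True
    then show ?thesis using relaxation_admissible[of x \<phi> \<epsilon> k] \<epsilon> unfolding good_def by blast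
  next
    case False
    then show ?thesis using Y_ne unfolding good_def by blast
  qed
  then have good: "good k \<phi> x (P k \<phi> x)" for k \<phi> x
    unfolding P_def by (rule someI_ex)
  have PY: "P k \<phi> x \<in> Y" for k \<phi> x
    using good unfolding good_def by blast
  have P: "(norm (P k \<phi> x - y))\<^sup>2 + relaxation k (\<lambda>f. \<phi> f - loss (x, y) f) \<le> relaxation (Suc k) \<phi> + \<epsilon>"
    if "x \<in> X" "bdd_on_F \<phi>" "y \<in> Y" for k \<phi> x y
    using good[of k \<phi> x] that unfolding good_def by blast
  define past where "past h f = - (\<Sum>z\<leftarrow>h. loss z f)" for h f
  \<comment> \<open>A deterministic learner, so measurability is immediate and the expectation is
    the value itself. \<open>T - Suc (length h)\<close> rounds remain after the current one.\<close>
  define A where "A = (\<lambda>(\<omega>::real) h x. P (T - Suc (length h)) (past h) x)"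
  have A: "A \<in> online_algorithms Y" by (auto simp: online_algorithms_def A_def PY)
  have "regret A T F X Y \<le> relaxation T (\<lambda>_. 0) + real T * \<epsilon>"
    unfolding regret_def
  proof (rule cSUP_least)
    have "replicate T (x, y) \<in> {s. length s = T \<and> set s \<subseteq> X \<times> Y}" if "x \<in> X" "y \<in> Y" for x y
      using that by (auto simp: set_replicate_conv_if)
    then show "{s. length s = T \<and> set s \<subseteq> X \<times> Y} \<noteq> {}" using X_ne Y_ne by blast
    fix s assume "s \<in> {s. length s = T \<and> set s \<subseteq> X \<times> Y}"
    then have s: "length s = T" "\<And>t. t < T \<Longrightarrow> s ! t \<in> X \<times> Y" by (auto dest!: nth_mem)
    define yhat where "yhat t = P (T - Suc t) (past (take t s)) (fst (s ! t))" for t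
    have bdd: "bdd_on_F (past (take t s))" if "t \<le> T" for t
    proof -
      have "past (take t s) = (\<lambda>f. - 1 * (\<Sum>i<t. loss (s ! i) f))"
        using that s(1) by (simp add: past_def fun_eq_iff sum_list_sum_nth atLeast0LessThan)
      moreover have "bdd_on_F (\<lambda>f. - 1 * (\<Sum>i<t. loss (s ! i) f))"
        using s that by (intro bdd_on_F_scale bdd_on_F_sum bdd_on_F_loss) auto
      ultimately show ?thesis by simp
    qed
    \<comment> \<open>The potential, loss so far plus relaxation of the remaining rounds, grows by
      at most \<open>\<epsilon>\<close> per round.\<close>
    have "(\<Sum>i<t. (norm (yhat i - snd (s ! i)))\<^sup>2) + relaxation (T - t) (past (take t s))
        \<le> relaxation T (\<lambda>_. 0) + real t * \<epsilon>" if "t \<le> T" for t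
      using that
    proof (induction t)
      case 0
      have "past [] = (\<lambda>_. 0)" by (simp add: past_def fun_eq_iff)
      then show ?case by simp
    next
      case (Suc t)
      then have t: "t < T" by simp
      have "past (take (Suc t) s) = (\<lambda>f. past (take t s) f - loss (fst (s ! t), snd (s ! t)) f)"
        using t s(1) by (simp add: past_def fun_eq_iff take_Suc_conv_app_nth)
      moreover have "Suc (T - Suc t) = T - t" using t by simp
      moreover have "fst (s ! t) \<in> X" "snd (s ! t) \<in> Y" using s(2)[OF t] by (auto simp: mem_Times_iff)
      ultimately have "(norm (yhat t - snd (s ! t)))\<^sup>2 + relaxation (T - Suc t) (past (take (Suc t) s))
          \<le> relaxation (T - t) (past (take t s)) + \<epsilon>"
        using P[of "fst (s ! t)" "past (take t s)" "snd (s ! t)" "T - Suc t"] bdd[of t] t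
        by (simp add: yhat_def)
      then show ?case using Suc by (simp add: algebra_simps)
    qed
    from this[of T] have le: "(\<Sum>i<T. (norm (yhat i - snd (s ! i)))\<^sup>2) + relaxation 0 (past s)
        \<le> relaxation T (\<lambda>_. 0) + real T * \<epsilon>"
      using s(1) by simp
    have "(\<integral>\<omega>. (\<Sum>t<T. (norm (A \<omega> (take t s) (fst (s ! t)) - snd (s ! t)))\<^sup>2) \<partial>rand_space)
        = (\<Sum>i<T. (norm (yhat i - snd (s ! i)))\<^sup>2)"
      using s(1) by (simp add: A_def yhat_def prob_space min_def)
    moreover have "- relaxation 0 (past s) \<le> (INF f\<in>F. \<Sum>t<T. (norm (f (fst (s ! t)) - snd (s ! t)))\<^sup>2)"
    proof (rule cINF_greatest[OF F_ne])
      fix f assume f: "f \<in> F"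
      have "past s f = - (\<Sum>t<T. (norm (f (fst (s ! t)) - snd (s ! t)))\<^sup>2)"
        using s(1) by (simp add: past_def loss_def sum_list_sum_nth atLeast0LessThan)
      moreover have "past s f \<le> relaxation 0 (past s)"
        using bdd[of T] s(1) f by (intro relaxation_0_ge) auto
      ultimately show "- relaxation 0 (past s) \<le> (\<Sum>t<T. (norm (f (fst (s ! t)) - snd (s ! t)))\<^sup>2)"
        by simp
    qed
    ultimately show "(\<integral>\<omega>. (\<Sum>t<T. (norm (A \<omega> (take t s) (fst (s ! t)) - snd (s ! t)))\<^sup>2) \<partial>rand_space)
        - (INF f\<in>F. \<Sum>t<T. (norm (f (fst (s ! t)) - snd (s ! t)))\<^sup>2)
        \<le> relaxation T (\<lambda>_. 0) + real T * \<epsilon>"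
      using le by linarith
  qed
  then show ?thesis using A by blast
qed

text \<open>Makes the infimum over learners a genuine one. Since the regret is itself a real
  \<open>SUP\<close>, its terms must first be bounded above.\<close>

lemma regret_lower_bound:
  assumes A: "A \<in> online_algorithms Y"
  shows "- (real T * B) \<le> regret A T F X Y"
proof -
  interpret prob_space rand_space by (rule prob_space_rand_space)
  let ?S = "{s. length s = T \<and> set s \<subseteq> X \<times> Y}"
  let ?L = "\<lambda>s. \<integral>\<omega>. (\<Sum>t<T. (norm (A \<omega> (take t s) (fst (s ! t)) - snd (s ! t)))\<^sup>2) \<partial>rand_space"
  let ?I = "\<lambda>s. INF f\<in>F. \<Sum>t<T. (norm (f (fst (s ! t)) - snd (s ! t)))\<^sup>2"
  have nth: "fst (s ! t) \<in> X" "snd (s ! t) \<in> Y" if "s \<in> ?S" "t < T" for s t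
  proof -
    have "s ! t \<in> X \<times> Y" using that nth_mem[of t s] by blast
    then show "fst (s ! t) \<in> X" "snd (s ! t) \<in> Y" by (simp_all add: mem_Times_iff)
  qed
  have I: "0 \<le> ?I s" "?I s \<le> real T * B" if s: "s \<in> ?S" for s
  proof -
    show "0 \<le> ?I s" by (intro cINF_greatest F_ne sum_nonneg) auto
    obtain f where f: "f \<in> F" using F_ne by blast
    have "?I s \<le> (\<Sum>t<T. (norm (f (fst (s ! t)) - snd (s ! t)))\<^sup>2)"
      using f by (intro cINF_lower bdd_belowI2[of _ 0] sum_nonneg) auto
    also have "\<dots> \<le> (\<Sum>t<T. B)" using f nth[OF s] by (intro sum_mono loss_le) auto
    finally show "?I s \<le> real T * B" by simp
  qed
  have L: "0 \<le> ?L s" "?L s \<le> real T * B" if s: "s \<in> ?S" for s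
  proof -
    show "0 \<le> ?L s" by (intro Bochner_Integration.integral_nonneg sum_nonneg) auto
    have AY: "A \<omega> h x \<in> Y" for \<omega> h x using A by (auto simp: online_algorithms_def)
    have le: "(\<Sum>t<T. (norm (A \<omega> (take t s) (fst (s ! t)) - snd (s ! t)))\<^sup>2) \<le> real T * B" for \<omega>
    proof -
      have "(\<Sum>t<T. (norm (A \<omega> (take t s) (fst (s ! t)) - snd (s ! t)))\<^sup>2) \<le> (\<Sum>t<T. B)"
        using nth[OF s] AY by (intro sum_mono diam_le) auto
      then show ?thesis by simp
    qed
    have "?L s \<le> (\<integral>\<omega>. real T * B \<partial>rand_space)"
      using le B_nonneg by (intro Bochner_Integration.integral_mono') (auto intro!: sum_nonneg)
    then show "?L s \<le> real T * B" by (simp add: prob_space)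
  qed
  obtain x y where xy: "x \<in> X" "y \<in> Y" using X_ne Y_ne by blast
  then have s0: "replicate T (x, y) \<in> ?S" by (auto simp: set_replicate_conv_if)
  have "bdd_above ((\<lambda>s. ?L s - ?I s) ` ?S)"
    by (rule bdd_aboveI2[of _ _ "real T * B"]) (use I L in fastforce)
  then have "?L (replicate T (x, y)) - ?I (replicate T (x, y)) \<le> regret A T F X Y"
    unfolding regret_def using s0 by (rule cSUP_upper[rotated])
  then show ?thesis using I(2)[OF s0] L(1)[OF s0] by linarith
qed

text \<open>The factor \<open>2\<close> leaves the inner and then the outer supremum; for real
  suprema each move needs nonemptiness and boundedness.\<close>

lemma relaxation_eq_seq_rademacher: "relaxation T (\<lambda>_. 0) = 2 * seq_rademacher T F X Y"
proof -
  let ?R = "\<lambda>z. (\<Sum>\<sigma> | length \<sigma> = T. SUP f\<in>F. path_sum T z \<sigma> f) / 2 ^ T"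
  have eq: "tree_value T z (\<lambda>_. 0) = 2 * ?R z" if z: "z \<in> trees T" for z
  proof -
    have "(SUP f\<in>F. 2 * path_sum T z \<sigma> f) = 2 * (SUP f\<in>F. path_sum T z \<sigma> f)"
      if "length \<sigma> = T" for \<sigma>
      using path_sum_bounds[OF z that]
      by (intro cSUP_mult_left_real F_ne bdd_aboveI2[of _ _ "real T * B"]) (auto simp: abs_le_iff)
    then show ?thesis by (simp add: tree_value_def sum_distrib_left)
  qed
  have "bdd_above (?R ` trees T)"
  proof -
    obtain C where C: "\<And>z. z \<in> trees T \<Longrightarrow> tree_value T z (\<lambda>_. 0) \<le> C"
      using bdd_above_tree_value[of "\<lambda>_. 0" T] by (auto simp: bdd_above_def)
    then have "?R z \<le> C / 2" if "z \<in> trees T" for z 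
      using eq[OF that] C[OF that] by linarith
    then show ?thesis by (rule bdd_aboveI2)
  qed
  then have "(SUP z\<in>trees T. 2 * ?R z) = 2 * (SUP z\<in>trees T. ?R z)"
    by (intro cSUP_mult_left_real trees_ne) auto
  moreover have "relaxation T (\<lambda>_. 0) = (SUP z\<in>trees T. 2 * ?R z)"
    unfolding relaxation_def using eq by (rule SUP_cong[OF refl])
  moreover have "seq_rademacher T F X Y = (SUP z\<in>trees T. ?R z)"
    unfolding seq_rademacher_def trees_def path_sum_def loss_def ..
  ultimately show ?thesis by simp
qed

lemma INF_regret_le_seq_rademacher:
  "(INF A\<in>online_algorithms Y. regret A T F X Y) \<le> 2 * seq_rademacher T F X Y"
proof (rule field_le_epsilon)
  fix e :: real assume e: "e > 0"
  \<comment> \<open>The slack \<open>e\<close> is spread over the rounds; the \<open>+ 1\<close>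
    covers \<open>T = 0\<close>.\<close>
  define \<epsilon> where "\<epsilon> = e / (real T + 1)"
  have \<epsilon>: "\<epsilon> > 0" "real T * \<epsilon> \<le> e" using e by (auto simp: \<epsilon>_def field_simps)
  obtain A where A: "A \<in> online_algorithms Y"
    and le: "regret A T F X Y \<le> relaxation T (\<lambda>_. 0) + real T * \<epsilon>"
    using regret_le_relaxation[OF \<epsilon>(1)] by blast
  have "(INF A\<in>online_algorithms Y. regret A T F X Y) \<le> regret A T F X Y"
    using regret_lower_bound A by (intro cINF_lower bdd_belowI2) auto
  then show "(INF A\<in>online_algorithms Y. regret A T F X Y) \<le> 2 * seq_rademacher T F X Y + e"
    using le \<epsilon>(2) unfolding relaxation_eq_seq_rademacher by linarith
qed

end

theorem theorem1:
  fixes c :: real and p :: ereal and T :: nat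
  assumes sepV: "\<exists>D::'v::{real_inner,complete_space} set. countable D \<and> closure D = UNIV"
    and sepW: "\<exists>D::'w::{real_inner,complete_space} set. countable D \<and> closure D = UNIV"
    and infV: "\<not> (\<exists>B::'v set. finite B \<and> span B = UNIV)"
    and infW: "\<not> (\<exists>B::'w set. finite B \<and> span B = UNIV)"
    and c: "c > 0" and p: "p \<ge> 1"
  shows "(INF A\<in>online_algorithms (cball (0::'w) c).
            regret A T (schatten_ball p c :: ('v \<Rightarrow> 'w) set) (cball 0 1) (cball 0 c))
           \<le> 2 * seq_rademacher T (schatten_ball p c :: ('v \<Rightarrow> 'w) set) (cball 0 1) (cball 0 c)
       \<and> 2 * seq_rademacher T (schatten_ball p c :: ('v \<Rightarrow> 'w) set) (cball 0 1) (cball 0 c)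
           \<le> 6 * c^2 * real T powr (if p = \<infinity> then 1 else max (1/2) (1 - 1 / real_of_ereal p))"
proof
  let ?F = "schatten_ball p c :: ('v \<Rightarrow> 'w) set"
  \<comment> \<open>\<open>B\<close> is the squared diameter of the label ball; values of
    \<open>f\<close> on the unit ball lie there too, the operator norm being at most
    \<open>c\<close>.\<close>
  interpret square_loss_game ?F "cball 0 1" "cball 0 c" "(2 * c)\<^sup>2"
  proof
    show "?F \<noteq> {}" using zero_in_schatten_ball[OF c p] by blast
    show "cball (0::'v) 1 \<noteq> {}" "cball (0::'w) c \<noteq> {}" using c by simp_all
    show "(norm (f x - y))\<^sup>2 \<le> (2 * c)\<^sup>2"
      if f: "f \<in> ?F" and x: "x \<in> cball 0 1" and y: "y \<in> cball 0 c" for f x y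
    proof (rule power_mono)
      have "c * norm x \<le> c * 1" using x c by (intro mult_left_mono) auto
      then show "norm (f x - y) \<le> 2 * c"
        using schatten_ball_norm_le[OF infV f c p, of x] y norm_triangle_ineq4[of "f x" y] by simp
    qed simp
    show "(norm (y - y'))\<^sup>2 \<le> (2 * c)\<^sup>2" if "y \<in> cball 0 c" "y' \<in> cball 0 c" for y y' :: 'w
      using that norm_triangle_ineq4[of y y'] by (intro power_mono) auto
  qed simp
  show "(INF A\<in>online_algorithms (cball (0::'w) c). regret A T ?F (cball 0 1) (cball 0 c))
      \<le> 2 * seq_rademacher T ?F (cball 0 1) (cball 0 c)"
    by (rule INF_regret_le_seq_rademacher)
  show "2 * seq_rademacher T ?F (cball 0 1) (cball 0 c)
      \<le> 6 * c^2 * real T powr (if p = \<infinity> then 1 else max (1/2) (1 - 1 / real_of_ereal p))"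
    using seq_rademacher_schatten_ball_le[where 'w = 'w, OF infV c p, of T]
    by (simp add: schatten_exponent_def)
qed

end
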